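(* Let $k\ge d$ and suppose $y^*$ is an optimizer of the $k$-th order moment relaxation. If $y^*$ satisfies the flat truncation condition $$\operatorname{rank} M_t[y^*]=\operatorname{rank} M_{t-d}[y^*]$$ for some integer $t\in[d,k]$, then $f_{\mathrm{mom},k}=f_{\mathrm{mom}}$, and, with $r=\operatorname{rank}M_t[y^*]$, there exist distinct points $v_1^*,\ldots,v_r^*\in K$ and positive scalars $\lambda_1,\ldots,\lambda_r$ such that $$y^*|_{2t}=\lambda_1[v_1^*]_{2t}+\cdots+\lambda_r[v_r^*]_{2t}.$$ If in addition $p(v_1^* )=\cdots=p(v_r^* )$, where $p=(p_1,\ldots,p_m)$, then $f_{\max}=f_{\mathrm{mom}}=f_{\mathrm{mom},k}$ and all of $v_1^*,\ldots,v_r^*$ are global maximizers of $\sum_{i=1}^m a_i\log p_i(x)$ over $x\in K$.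
   Context: Let $n,m\ge 1$ be integers, $a_1,\ldots,a_m>0$ real numbers, $\mathcal{E}$ and $\mathcal{I}$ finite disjoint label sets, and $p_1,\ldots,p_m$, $c_j$ ($j\in\mathcal{E}\cup\mathcal{I}$) real polynomials in $x=(x_1,\ldots,x_n)$. Let $$K=\{x\in\mathbb{R}^n: c_j(x)=0\ (j\in\mathcal{E}),\ c_j(x)\ge 0\ (j\in\mathcal{I})\}.$$ Standing assumption: $p_i\ge 0$ on $K$ for all $i$, and there is $\hat{x}\in K$ with $p_i(\hat{x})>0$ for all $i=1,\ldots,m$. Convention: $\log t=-\infty$ for $t\le 0$. Optimal values are suprema in the extended reals. $f_{\max}$ is the optimal value of the log-polynomial optimization problem of maximizing $\sum_{i=1}^m a_i\log p_i(x)$ over $x\in K$. Let $d$ be the maximum of $\lceil\deg(q)/2\rceil$ over all $q\in\{p_1,\ldots,p_m\}\cup\{c_j:j\in\mathcal{E}\cup\mathcal{I}\}$; it is understood that $d\ge 1$. For $k\ge 0$ let $\mathbb{N}^n_{k}=\{\alpha\in\mathbb{N}^n:|\alpha|\le k\}$ and $[x]_{k}=(x^\alpha)_{\alpha\in\mathbb{N}^n_{k}}$. For $y=(y_\alpha)\in\mathbb{R}^{\mathbb{N}^n_{2k}}$ and a polynomial $q=\sum_\alpha q_\alpha x^\alpha$ of degree $\le 2k$, put $\langle q,y\rangle=\sum_\alpha q_\alpha y_\alpha$. For $t\le k$, $y|_{2t}=(y_\alpha)_{\alpha\in\mathbb{N}^n_{2t}}$ is the truncation of $y$ and $M_t[y]=[y_{\alpha+\beta}]_{\alpha,\beta\in\mathbb{N}^n_t}$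 is the $t$-th order moment matrix. For $\deg q\le 2k$ and $s=k-\lceil\deg(q)/2\rceil$, the localizing matrix $L_q^{(k)}[y]$ is obtained by applying the linear map $x^\alpha\mapsto y_\alpha$ entrywise to $q(x)[x]_s[x]_s^T$. Define $$\mathscr{R}_d(K)=\Big\{\sum_{j=1}^l\lambda_j[v_j]_{2d}:\lambda_j\ge 0,\ v_j\in K,\ l\in\mathbb{N}\Big\},$$ and let $f_{\mathrm{mom}}$ be the optimal value of maximizing $\sum_{i=1}^m a_i\log\langle p_i,z\rangle$ subject to $z_0=1$, $z\in\mathscr{R}_d(K)$. For $k\ge d$, the $k$-th order moment relaxation is to maximize $\sum_{i=1}^m a_i\log\langle p_i,y\rangle$ over $y\in\mathbb{R}^{\mathbb{N}^n_{2k}}$ subject to $y_0=1$, $M_k[y]\succeq 0$, $L_{c_j}^{(k)}[y]=0$ ($j\in\mathcal{E}$), $L_{c_j}^{(k)}[y]\succeq 0$ ($j\in\mathcal{I}$); its optimal value is $f_{\mathrm{mom},k}$. *)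

theory Defs
  imports "HOL-Analysis.Analysis" "HOL-Analysis.Finite_Function_Topology"
begin

section \<open>Polynomials in the coordinates of a point of \<open>real ^ 'n\<close>\<close>

type_synonym 'n mindex = "'n \<Rightarrow>\<^sub>0 nat"
type_synonym 'n mpoly = "'n mindex \<Rightarrow>\<^sub>0 real"

definition mabs :: "'n::finite mindex \<Rightarrow> nat" where
  "mabs \<alpha> = (\<Sum>i\<in>UNIV. Poly_Mapping.lookup \<alpha> i)"

definition mindices :: "nat \<Rightarrow> 'n::finite mindex set" where
  "mindices k = {\<alpha>. mabs \<alpha> \<le> k}"

definition mpower :: "real ^ 'n \<Rightarrow> 'n::finite mindex \<Rightarrow> real" where
  "mpower x \<alpha> = (\<Prod>i\<in>UNIV. (x $ i) ^ Poly_Mapping.lookup \<alpha> i)"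

definition peval :: "'n::finite mpoly \<Rightarrow> real ^ 'n \<Rightarrow> real" where
  "peval q x = (\<Sum>\<alpha>\<in>Poly_Mapping.keys q. Poly_Mapping.lookup q \<alpha> * mpower x \<alpha>)"

text \<open>Total degree; the zero polynomial gets degree 0.\<close>
definition tdeg :: "'n::finite mpoly \<Rightarrow> nat" where
  "tdeg q = Max (insert 0 (mabs ` Poly_Mapping.keys q))"

definition half_deg :: "'n::finite mpoly \<Rightarrow> nat" where
  "half_deg q = nat \<lceil>real (tdeg q) / 2\<rceil>"

section \<open>Matrices indexed by a finite set\<close>

text \<open>A matrix with rows and columns indexed by a finite set \<open>I\<close> is a function of two
  arguments that is only inspected on \<open>I\<close>. Its rank is the dimension of its column space;
  the column with index \<open>\<beta>\<close> is the finitely supported vector with entries \<open>A \<alpha> \<beta>\<close>, \<open>\<alpha> \<in> I\<close>,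
  and \<open>dim\<close> of a set is the dimension of its linear span.\<close>
definition mat_rank :: "'i set \<Rightarrow> ('i \<Rightarrow> 'i \<Rightarrow> real) \<Rightarrow> nat" where
  "mat_rank I A = dim ((\<lambda>\<beta>. \<Sum>\<alpha>\<in>I. Poly_Mapping.single \<alpha> (A \<alpha> \<beta>)) ` I)"

definition mat_psd :: "'i set \<Rightarrow> ('i \<Rightarrow> 'i \<Rightarrow> real) \<Rightarrow> bool" where
  "mat_psd I A \<longleftrightarrow> (\<forall>\<alpha>\<in>I. \<forall>\<beta>\<in>I. A \<alpha> \<beta> = A \<beta> \<alpha>) \<and>
     (\<forall>u. 0 \<le> (\<Sum>\<alpha>\<in>I. \<Sum>\<beta>\<in>I. u \<alpha> * A \<alpha> \<beta> * u \<beta>))"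

definition mat_zero :: "'i set \<Rightarrow> ('i \<Rightarrow> 'i \<Rightarrow> real) \<Rightarrow> bool" where
  "mat_zero I A \<longleftrightarrow> (\<forall>\<alpha>\<in>I. \<forall>\<beta>\<in>I. A \<alpha> \<beta> = 0)"

section \<open>Truncated multi-sequences\<close>

text \<open>The space of real vectors indexed by \<open>mindices k\<close> is \<open>extensional (mindices k)\<close>, and
  truncation is \<open>restrict\<close>.\<close>
definition mvec :: "nat \<Rightarrow> real ^ 'n \<Rightarrow> 'n::finite mindex \<Rightarrow> real" where
  "mvec k x = restrict (mpower x) (mindices k)"

definition riesz :: "'n::finite mpoly \<Rightarrow> ('n mindex \<Rightarrow> real) \<Rightarrow> real" where
  "riesz q y = (\<Sum>\<alpha>\<in>Poly_Mapping.keys q. Poly_Mapping.lookup q \<alpha> * y \<alpha>)"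

definition moment_mat :: "('n::finite mindex \<Rightarrow> real) \<Rightarrow> 'n mindex \<Rightarrow> 'n mindex \<Rightarrow> real" where
  "moment_mat y \<alpha> \<beta> = y (\<alpha> + \<beta>)"

text \<open>The entries of the localizing matrix; its index set is \<open>mindices (k - half_deg q)\<close>.\<close>
definition localizing_mat ::
  "'n::finite mpoly \<Rightarrow> ('n mindex \<Rightarrow> real) \<Rightarrow> 'n mindex \<Rightarrow> 'n mindex \<Rightarrow> real" where
  "localizing_mat q y \<alpha> \<beta> =
     riesz (q * Poly_Mapping.single \<alpha> 1 * Poly_Mapping.single \<beta> 1) y"

section \<open>The optimization problems\<close>

definition elog :: "real \<Rightarrow> ereal" where
  "elog t = (if t \<le> 0 then -\<infinity> else ereal (ln t))"

definition feasible_set :: "'j set \<Rightarrow> 'j set \<Rightarrow> ('j \<Rightarrow> 'n::finite mpoly) \<Rightarrow> (real ^ 'n) set" where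
  "feasible_set E I c = {x. (\<forall>j\<in>E. peval (c j) x = 0) \<and> (\<forall>j\<in>I. peval (c j) x \<ge> 0)}"

definition log_obj :: "nat \<Rightarrow> (nat \<Rightarrow> real) \<Rightarrow> (nat \<Rightarrow> 'n::finite mpoly) \<Rightarrow> real ^ 'n \<Rightarrow> ereal" where
  "log_obj m a p x = (\<Sum>i=1..m. ereal (a i) * elog (peval (p i) x))"

definition mom_obj ::
  "nat \<Rightarrow> (nat \<Rightarrow> real) \<Rightarrow> (nat \<Rightarrow> 'n::finite mpoly) \<Rightarrow> ('n mindex \<Rightarrow> real) \<Rightarrow> ereal" where
  "mom_obj m a p y = (\<Sum>i=1..m. ereal (a i) * elog (riesz (p i) y))"

definition f_max ::
  "nat \<Rightarrow> (nat \<Rightarrow> real) \<Rightarrow> (nat \<Rightarrow> 'n::finite mpoly) \<Rightarrow> (real ^ 'n) set \<Rightarrow> ereal" where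
  "f_max m a p K = (SUP x\<in>K. log_obj m a p x)"

definition moment_cone :: "nat \<Rightarrow> (real ^ 'n) set \<Rightarrow> ('n::finite mindex \<Rightarrow> real) set" where
  "moment_cone d K = {z. \<exists>(l::nat) lam v. (\<forall>j\<in>{1..l}. lam j \<ge> 0 \<and> v j \<in> K) \<and>
     z = (\<lambda>\<alpha>\<in>mindices (2 * d). \<Sum>j=1..l. lam j * mvec (2 * d) (v j) \<alpha>)}"

definition f_mom ::
  "nat \<Rightarrow> (nat \<Rightarrow> real) \<Rightarrow> (nat \<Rightarrow> 'n::finite mpoly) \<Rightarrow> nat \<Rightarrow> (real ^ 'n) set \<Rightarrow> ereal" where
  "f_mom m a p d K = (SUP z\<in>{z \<in> moment_cone d K. z 0 = 1}. mom_obj m a p z)"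

definition relax_feasible ::
  "'j set \<Rightarrow> 'j set \<Rightarrow> ('j \<Rightarrow> 'n::finite mpoly) \<Rightarrow> nat \<Rightarrow> ('n mindex \<Rightarrow> real) set" where
  "relax_feasible E I c k = {y \<in> extensional (mindices (2 * k)).
     y 0 = 1 \<and> mat_psd (mindices k) (moment_mat y) \<and>
     (\<forall>j\<in>E. mat_zero (mindices (k - half_deg (c j))) (localizing_mat (c j) y)) \<and>
     (\<forall>j\<in>I. mat_psd (mindices (k - half_deg (c j))) (localizing_mat (c j) y))}"

definition f_mom_relax ::
  "nat \<Rightarrow> (nat \<Rightarrow> real) \<Rightarrow> (nat \<Rightarrow> 'n::finite mpoly) \<Rightarrow> 'j set \<Rightarrow> 'j set \<Rightarrow>
   ('j \<Rightarrow> 'n mpoly) \<Rightarrow> nat \<Rightarrow> ereal" where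
  "f_mom_relax m a p E I c k = (SUP y\<in>relax_feasible E I c k. mom_obj m a p y)"

definition atomic_decomp ::
  "(real ^ 'n) set \<Rightarrow> nat \<Rightarrow> ('n::finite mindex \<Rightarrow> real) \<Rightarrow> nat \<Rightarrow>
   (nat \<Rightarrow> real ^ 'n) \<Rightarrow> (nat \<Rightarrow> real) \<Rightarrow> bool" where
  "atomic_decomp K t y r v lam \<longleftrightarrow>
     inj_on v {1..r} \<and> (\<forall>j\<in>{1..r}. v j \<in> K \<and> lam j > 0) \<and>
     restrict y (mindices (2 * t)) =
       (\<lambda>\<alpha>\<in>mindices (2 * t). \<Sum>j=1..r. lam j * mvec (2 * t) (v j) \<alpha>)"

end

theory Submission
  imports Defs "HOL-Computational_Algebra.Fundamental_Theorem_Algebra"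
begin

text \<open>The heart of the matter is that a positive functional \<open>L\<close> with a flat truncation is a finite sum of
  point evaluations at feasible points. Once this is known, the optimizer \<open>y\<close> of the relaxation
  truncates to a feasible point of the moment problem, and the optimal values coincide because the
  relaxation never lies below the moment problem, which in turn never lies below the original one.

  Flatness says that, modulo the kernel of the form \<open>(f, g) \<mapsto> L (f g)\<close>, every polynomial of degree
  at most \<open>t\<close> can be replaced by one of degree at most \<open>t - d\<close> (\<open>flat_reduction\<close>). As \<open>d \<ge> 1\<close>,
  multiplication by a coordinate therefore acts on the finite-dimensional quotient of the
  polynomials of degree at most \<open>t\<close> by the kernel. These multiplications are self-adjoint and commute,
  so they have an orthonormal basis of joint eigenvectors, each represented by a polynomial of
  degree at most \<open>t - d\<close> (\<open>eigenbasis\<close>). The joint eigenvalues are the coordinates of the atoms, and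
  Parseval's identity is the decomposition of \<open>L\<close> (\<open>flat_truncation_quadrature\<close>); the number of atoms
  is the dimension of the quotient, that is, the rank of the moment matrix. Up to a factor the
  eigenvectors are interpolation polynomials at the atoms. Their degree is small enough to be
  inserted into the localizing constraints, which then say exactly that the atoms are feasible
  (\<open>flat_truncation_atomic_decomp\<close>).\<close>

section \<open>Joint eigenvectors modulo the kernel of a positive form\<close>

text \<open>Abstract setting of a flat truncation. \<open>P\<close> stands for the polynomials of degree at most \<open>t\<close>,
  \<open>Q\<close> for those of degree at most \<open>t - d\<close>, \<open>B\<close> for the form \<open>(f, g) \<mapsto> L (f * g)\<close>, and \<open>X i\<close> for
  multiplication by the \<open>i\<close>-th coordinate. The assumption \<open>flat\<close> says that \<open>Q\<close> already represents
  every class of \<open>P\<close> modulo the kernel of \<open>B\<close>. Instead of forming the quotient Hilbert space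
  \<open>P / N\<close>, on which the \<open>X i\<close> become commuting self-adjoint operators, all statements below are
  about representatives in \<open>Q\<close> modulo the kernel \<open>N\<close>; no quotient type of variable dimension is
  then needed.\<close>
locale flat_form =
  fixes B :: "'v::real_vector \<Rightarrow> 'v \<Rightarrow> real"
    and P Q S :: "'v set" and X :: "'i \<Rightarrow> 'v \<Rightarrow> 'v"
  assumes linear_B: "linear (\<lambda>f. B f g)"
    and sym: "B f g = B g f"
    and subspace_P: "subspace P" and subspace_Q: "subspace Q" and Q_sub_P: "Q \<subseteq> P"
    and finite_S: "finite S" and P_span: "P \<subseteq> span S"
    and nonneg: "f \<in> P \<Longrightarrow> 0 \<le> B f f"
    and flat: "f \<in> P \<Longrightarrow> \<exists>q\<in>Q. \<forall>g\<in>P. B (f - q) g = 0"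
    and linear_X: "linear (X i)"
    and X_Q: "f \<in> Q \<Longrightarrow> X i f \<in> P"
    and X_adj: "B (X i f) g = B f (X i g)"
    and X_comm: "X i (X j f) = X j (X i f)"
begin

definition N :: "'v set" where "N = {f \<in> P. \<forall>g\<in>P. B f g = 0}"

lemmas B_simps = linear_add[OF linear_B] linear_diff[OF linear_B] linear_scale[OF linear_B]
  linear_0[OF linear_B] linear_sum[OF linear_B] linear_neg[OF linear_B]

lemma linear_B2: "linear (\<lambda>g. B f g)"
  using linear_B by (simp add: sym[of f])

lemmas B_simps2 = linear_add[OF linear_B2] linear_diff[OF linear_B2] linear_scale[OF linear_B2]
  linear_0[OF linear_B2] linear_sum[OF linear_B2] linear_neg[OF linear_B2]

lemma subspace_N: "subspace N"
  using subspace_P by (auto simp: subspace_def N_def B_simps)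

lemma B_N: "f \<in> N \<Longrightarrow> g \<in> P \<Longrightarrow> B f g = 0"
  by (auto simp: N_def)

lemma B_cong_N: "f - f' \<in> N \<Longrightarrow> g \<in> P \<Longrightarrow> B f g = B f' g"
  using B_N[of "f - f'" g] by (simp add: B_simps)

lemma N_trans: "f - g \<in> N \<Longrightarrow> g - h \<in> N \<Longrightarrow> f - h \<in> N"
  using subspace_add[OF subspace_N, of "f - g" "g - h"] by simp

lemma flat_N: assumes "f \<in> P" obtains q where "q \<in> Q" "f - q \<in> N"
  using flat[OF assms] assms subspace_diff[OF subspace_P] Q_sub_P by (auto simp: N_def)

text \<open>Flatness lets the degree drop on the test side as well: it suffices to test against \<open>Q\<close>,
  where multiplication by \<open>X i\<close> stays inside \<open>P\<close>.\<close>
lemma N_if_orthogonal_Q: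
  assumes f: "f \<in> P" and o: "\<And>g. g \<in> Q \<Longrightarrow> B f g = 0" shows "f \<in> N"
proof -
  have "B f g = 0" if g: "g \<in> P" for g
  proof -
    obtain q where q: "q \<in> Q" "g - q \<in> N" using flat_N[OF g] .
    have "B g f = B q f" by (rule B_cong_N[OF q(2) f])
    then show ?thesis using o[OF q(1)] by (simp add: sym)
  qed
  with f show ?thesis by (auto simp: N_def)
qed

lemma N_if_isotropic: assumes f: "f \<in> P" and z: "B f f = 0" shows "f \<in> N"
proof -
  have "B f g = 0" if g: "g \<in> P" for g
  proof (rule ccontr)
    assume n: "B f g \<noteq> 0"
    \<comment> \<open>The real function \<open>s \<mapsto> B (g + s f) (g + s f)\<close> is affine because \<open>B f f = 0\<close>, so it would take
      the value \<open>-1\<close>, which contradicts positivity.\<close>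
    define s where "s = - (B g g + 1) / (2 * B f g)"
    have "0 \<le> B (g + s *\<^sub>R f) (g + s *\<^sub>R f)"
      by (intro nonneg subspace_add[OF subspace_P] subspace_scale[OF subspace_P] f g)
    also have "\<dots> = B g g + 2 * s * B f g"
      by (simp add: B_simps B_simps2 z sym[of g f])
    also have "\<dots> = -1" using n by (simp add: s_def field_simps)
    finally show False by simp
  qed
  with f show ?thesis by (auto simp: N_def)
qed

lemma pos_if_not_N: "f \<in> P \<Longrightarrow> f \<notin> N \<Longrightarrow> 0 < B f f"
  using N_if_isotropic nonneg by force

lemma finite_dependence:
  assumes w: "\<And>k. w k \<in> P"
  obtains M :: nat and f where "\<exists>k\<le>M. f k \<noteq> 0" "(\<Sum>k\<le>M. f k *\<^sub>R w k) = 0"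
proof (cases "inj_on w {..card S}")
  case False
  then obtain i j where ij: "i \<le> card S" "j \<le> card S" "i \<noteq> j" "w i = w j"
    by (auto simp: inj_on_def)
  define f :: "nat \<Rightarrow> real" where "f k = (if k = i then 1 else 0) - (if k = j then 1 else 0)" for k
  have "(\<Sum>k\<le>card S. f k *\<^sub>R w k) = 0"
    using ij by (simp add: f_def scaleR_diff_left sum_subtractf if_distrib[of "\<lambda>c. c *\<^sub>R _"] cong: if_cong)
  moreover have "f i \<noteq> 0" using ij by (simp add: f_def)
  ultimately show ?thesis using that ij(1) by blast
next
  case True
  have "dependent (w ` {..card S})"
  proof (rule ccontr)
    assume "\<not> dependent (w ` {..card S})"
    with independent_span_bound[OF finite_S this] w P_span
    have "card (w ` {..card S}) \<le> card S" by blast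
    then show False by (simp add: card_image[OF True])
  qed
  then obtain u where u: "\<exists>v\<in>w ` {..card S}. u v \<noteq> 0" "(\<Sum>v\<in>w ` {..card S}. u v *\<^sub>R v) = 0"
    by (subst (asm) dependent_finite) auto
  then have "(\<Sum>k\<le>card S. u (w k) *\<^sub>R w k) = 0"
    by (simp add: sum.reindex[OF True])
  with u(1) show ?thesis using that[of "card S" "\<lambda>k. u (w k)"] by auto
qed

text \<open>The subspace \<open>U\<close>, read modulo \<open>N\<close>, is invariant under \<open>X i\<close>.\<close>
definition stable :: "'v set \<Rightarrow> 'i \<Rightarrow> bool" where
  "stable U i \<longleftrightarrow> (\<forall>u\<in>U. \<exists>u'\<in>U. X i u - u' \<in> N)"

text \<open>A self-adjoint operator on a nonzero finite-dimensional space has a real eigenvector. On the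
  Krylov sequence of a vector outside the kernel choose a complex polynomial \<open>p\<close> of least degree
  that annihilates that vector. A root \<open>z\<close> of \<open>p\<close> exists by the fundamental theorem of algebra, and
  the cofactor \<open>p / (x - z)\<close> yields a complex eigenvector \<open>a + \<i> b\<close> with eigenvalue \<open>z\<close>. Comparing
  \<open>B (X i a) b\<close> with \<open>B (X i b) a\<close> gives \<open>Im z * (B a a + B b b) = 0\<close>, so \<open>z\<close> is real and one of
  \<open>a\<close>, \<open>b\<close> is a real eigenvector.\<close>
lemma eigenvector:
  assumes U: "subspace U" "U \<subseteq> Q" and st: "stable U i" and ne: "\<not> U \<subseteq> N"
  obtains u c where "u \<in> U" "u \<notin> N" "X i u - c *\<^sub>R u \<in> N"
proof -
  obtain u where u: "u \<in> U" "u \<notin> N" using ne by auto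
  obtain T where T: "\<And>u. u \<in> U \<Longrightarrow> T u \<in> U" "\<And>u. u \<in> U \<Longrightarrow> X i u - T u \<in> N"
    using st unfolding stable_def by metis
  define w where "w k = (T ^^ k) u" for k
  have wU: "w k \<in> U" for k by (induction k) (auto simp: w_def u T)
  have UP: "U \<subseteq> P" using U Q_sub_P by auto
  have Xw: "X i (w k) - w (Suc k) \<in> N" for k using T(2)[OF wU[of k]] by (simp add: w_def)
  \<comment> \<open>\<open>ev Re p\<close> and \<open>ev Im p\<close> are the real and the imaginary part of \<open>p (X i) u\<close> modulo \<open>N\<close>.\<close>
  define ev where "ev g p = (\<Sum>k\<le>degree p. g (coeff p k) *\<^sub>R w k)" for g :: "complex \<Rightarrow> real" and p
  define ann where "ann p \<longleftrightarrow> ev Re p \<in> N \<and> ev Im p \<in> N" for p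
  have "\<exists>p. p \<noteq> 0 \<and> ann p"
  proof -
    obtain M f where f: "\<exists>k\<le>M. f k \<noteq> 0" "(\<Sum>k\<le>M. f k *\<^sub>R w k) = 0"
      using finite_dependence[of w] wU UP by blast
    define p where "p = Poly (map (\<lambda>k. complex_of_real (f k)) [0..<Suc M])"
    have cp: "coeff p k = (if k \<le> M then of_real (f k) else 0)" for k
      by (auto simp: p_def nth_default_def simp del: upt_Suc)
    have dp: "degree p \<le> M" by (rule degree_le) (simp add: cp)
    have "p \<noteq> 0" using f(1) cp by (metis coeff_0 of_real_eq_0_iff)
    moreover have "ev Re p = (\<Sum>k\<le>M. f k *\<^sub>R w k)"
    proof -
      have "ev Re p = (\<Sum>k\<le>M. Re (coeff p k) *\<^sub>R w k)"
        unfolding ev_def by (rule sum.mono_neutral_left) (use dp in \<open>auto simp: coeff_eq_0\<close>)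
      then show ?thesis by (simp add: cp)
    qed
    moreover have "ev Im p = 0" by (auto simp: ev_def cp intro!: sum.neutral)
    ultimately show ?thesis using f(2) subspace_0[OF subspace_N] by (auto simp: ann_def)
  qed
  then obtain p where p: "p \<noteq> 0" "ann p" and min: "\<And>q. q \<noteq> 0 \<Longrightarrow> ann q \<Longrightarrow> degree p \<le> degree q"
    using exists_least_iff[of "\<lambda>n. \<exists>p. p \<noteq> 0 \<and> ann p \<and> degree p = n"] by (metis not_le)
  have "degree p \<noteq> 0"
  proof
    assume d0: "degree p = 0"
    then have "Re (coeff p 0) *\<^sub>R u \<in> N" "Im (coeff p 0) *\<^sub>R u \<in> N"
      using p(2) by (auto simp: ann_def ev_def w_def)
    moreover have "c = 0" if "c *\<^sub>R u \<in> N" for c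
      using subspace_scale[OF subspace_N that, of "inverse c"] u(2) by (cases "c = 0") auto
    ultimately have "coeff p 0 = 0" by (simp add: complex_eq_iff)
    then show False using d0 p(1) by (metis leading_coeff_0_iff)
  qed
  then obtain z where z: "poly p z = 0"
    using fundamental_theorem_of_algebra[of p] by (auto simp: constant_degree)
  then obtain q where q: "p = [:-z, 1:] * q" by (metis poly_eq_0_iff_dvd dvdE)
  define M where "M = degree p"
  have "q \<noteq> 0" using p(1) q by auto
  then have dq: "M = Suc (degree q)" by (simp add: M_def q degree_mult_eq del: mult_pCons_left)
  define a where "a = ev Re q"
  define b where "b = ev Im q"
  have nab: "a \<notin> N \<or> b \<notin> N"
    using min[OF \<open>q \<noteq> 0\<close>] dq by (auto simp: ann_def a_def b_def M_def)
  have abU: "a \<in> U" "b \<in> U"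
    unfolding a_def b_def ev_def by (auto intro!: subspace_sum[OF U(1)] subspace_scale[OF U(1)] wU)
  \<comment> \<open>The part of \<open>x * q\<close>: shifting the coefficients of \<open>q\<close> amounts to applying \<open>X i\<close> modulo \<open>N\<close>.\<close>
  define sh where "sh g = (\<Sum>k\<le>degree q. g (coeff q k) *\<^sub>R w (Suc k))" for g :: "complex \<Rightarrow> real"
  have Xev: "X i (ev g q) - sh g \<in> N" for g
  proof -
    have "X i (ev g q) - sh g = (\<Sum>k\<le>degree q. g (coeff q k) *\<^sub>R (X i (w k) - w (Suc k)))"
      by (simp add: ev_def sh_def linear_sum[OF linear_X] linear_scale[OF linear_X]
          scaleR_diff_right sum_subtractf)
    also have "\<dots> \<in> N"
      by (intro subspace_sum[OF subspace_N] subspace_scale[OF subspace_N] Xw)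
    finally show ?thesis .
  qed
  have cp: "coeff p k = coeff (pCons 0 q) k - z * coeff q k" for k
    by (simp add: q)
  have ext: "(\<Sum>k\<le>M. g (coeff q k) *\<^sub>R w k) = ev g q" if "g 0 = 0" for g :: "complex \<Rightarrow> real"
    using that by (simp add: ev_def dq coeff_eq_0)
  have shift: "(\<Sum>k\<le>M. g (coeff (pCons 0 q) k) *\<^sub>R w k) = sh g" if "g 0 = 0" for g :: "complex \<Rightarrow> real"
    unfolding dq sh_def by (subst sum.atMost_Suc_shift) (simp add: that)
  have "ev Re p = sh Re - (Re z *\<^sub>R a - Im z *\<^sub>R b)"
  proof -
    have "ev Re p = (\<Sum>k\<le>M. Re (coeff (pCons 0 q) k) *\<^sub>R w k)
       - (Re z *\<^sub>R (\<Sum>k\<le>M. Re (coeff q k) *\<^sub>R w k) - Im z *\<^sub>R (\<Sum>k\<le>M. Im (coeff q k) *\<^sub>R w k))"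
      unfolding ev_def M_def[symmetric] scaleR_sum_right sum_subtractf[symmetric]
      by (rule sum.cong) (simp_all add: cp algebra_simps)
    then show ?thesis using ext shift by (simp add: a_def b_def)
  qed
  then have Xa: "X i a - (Re z *\<^sub>R a - Im z *\<^sub>R b) \<in> N"
    using N_trans[OF Xev[of Re], of "Re z *\<^sub>R a - Im z *\<^sub>R b"] p(2) by (simp add: a_def ann_def)
  have "ev Im p = sh Im - (Re z *\<^sub>R b + Im z *\<^sub>R a)"
  proof -
    have "ev Im p = (\<Sum>k\<le>M. Im (coeff (pCons 0 q) k) *\<^sub>R w k)
       - (Re z *\<^sub>R (\<Sum>k\<le>M. Im (coeff q k) *\<^sub>R w k) + Im z *\<^sub>R (\<Sum>k\<le>M. Re (coeff q k) *\<^sub>R w k))"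
      unfolding ev_def M_def[symmetric] scaleR_sum_right sum_subtractf[symmetric] sum.distrib[symmetric]
      by (rule sum.cong) (simp_all add: cp algebra_simps)
    then show ?thesis using ext shift by (simp add: a_def b_def)
  qed
  then have Xb: "X i b - (Re z *\<^sub>R b + Im z *\<^sub>R a) \<in> N"
    using N_trans[OF Xev[of Im], of "Re z *\<^sub>R b + Im z *\<^sub>R a"] p(2) by (simp add: b_def ann_def)
  have abP: "a \<in> P" "b \<in> P" using abU UP by auto
  have "B (X i a) b = B (X i b) a" by (metis X_adj sym)
  then have "Im z * (B a a + B b b) = 0"
    by (simp add: B_cong_N[OF Xa abP(2)] B_cong_N[OF Xb abP(1)] B_simps sym[of b a] algebra_simps)
  moreover have "B a a + B b b \<noteq> 0"
    using nab nonneg[OF abP(1)] nonneg[OF abP(2)] pos_if_not_N abP by fastforce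
  ultimately have "Im z = 0" by simp
  with Xa Xb nab abU that show ?thesis by auto
qed

text \<open>Commuting operators share an eigenvector: the eigenspace \<open>W\<close> of \<open>X j\<close> inside \<open>U\<close> is again
  stable under every \<open>X i\<close>, so the induction can continue inside \<open>W\<close>. Since \<open>X i\<close> leads out of \<open>Q\<close>,
  commutation is only used in the weak form \<open>B (X i u) (X j g) = B (X j u) (X i g)\<close>.\<close>
lemma common_eigenvector:
  assumes "finite J" and "subspace U" "U \<subseteq> Q" and "\<And>i. stable U i" and "\<not> U \<subseteq> N"
  shows "\<exists>u\<in>U. u \<notin> N \<and> (\<exists>c. \<forall>i\<in>J. X i u - c i *\<^sub>R u \<in> N)"
  using assms
proof (induction J arbitrary: U rule: finite_induct)
  case empty
  then show ?case by auto
next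
  case (insert j J)
  have UP: "U \<subseteq> P" using insert.prems Q_sub_P by auto
  obtain u0 c where u0: "u0 \<in> U" "u0 \<notin> N" "X j u0 - c *\<^sub>R u0 \<in> N"
    using eigenvector[OF insert.prems(1-2) insert.prems(3)[of j] insert.prems(4)] by blast
  define W where "W = {u \<in> U. X j u - c *\<^sub>R u \<in> N}"
  have sW: "subspace W"
    unfolding subspace_def
  proof (intro conjI ballI allI)
    show "0 \<in> W" using subspace_0[OF insert.prems(1)] subspace_0[OF subspace_N]
      by (simp add: W_def linear_0[OF linear_X])
    show "x + y \<in> W" if "x \<in> W" "y \<in> W" for x y
      using that subspace_add[OF insert.prems(1)] subspace_add[OF subspace_N, of "X j x - c *\<^sub>R x" "X j y - c *\<^sub>R y"]
      by (simp add: W_def linear_add[OF linear_X] algebra_simps)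
    show "s *\<^sub>R x \<in> W" if "x \<in> W" for s x
      using that subspace_scale[OF insert.prems(1)] subspace_scale[OF subspace_N, of "X j x - c *\<^sub>R x" s]
      by (simp add: W_def linear_scale[OF linear_X] algebra_simps)
  qed
  have stW: "stable W i" for i
    unfolding stable_def
  proof
    fix u assume "u \<in> W"
    then have u: "u \<in> U" "X j u - c *\<^sub>R u \<in> N" by (auto simp: W_def)
    obtain u' where u': "u' \<in> U" "X i u - u' \<in> N"
      using insert.prems(3)[of i] u(1) by (auto simp: stable_def)
    have Q: "u \<in> Q" "u' \<in> Q" using u u' insert.prems(2) by auto
    have "X j u' - c *\<^sub>R u' \<in> N"
    proof (rule N_if_orthogonal_Q)
      show "X j u' - c *\<^sub>R u' \<in> P"
        using Q Q_sub_P by (intro subspace_diff[OF subspace_P] subspace_scale[OF subspace_P] X_Q) auto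
      fix g assume g: "g \<in> Q"
      then have gP: "g \<in> P" using Q_sub_P by auto
      have "B (X j u') g = B u' (X j g)" by (rule X_adj)
      also have "\<dots> = B (X i u) (X j g)" by (rule B_cong_N[OF u'(2), symmetric]) (simp add: X_Q g)
      also have "\<dots> = B (X j u) (X i g)" by (simp add: X_adj X_comm[of i j])
      also have "\<dots> = c * B u (X i g)" by (simp add: B_cong_N[OF u(2)] X_Q g B_simps)
      also have "\<dots> = c * B (X i u) g" by (simp add: X_adj)
      also have "\<dots> = c * B u' g" by (simp add: B_cong_N[OF u'(2) gP])
      finally show "B (X j u' - c *\<^sub>R u') g = 0" by (simp add: B_simps)
    qed
    then show "\<exists>u'\<in>W. X i u - u' \<in> N" using u' by (auto simp: W_def)
  qed
  have "\<not> W \<subseteq> N" "W \<subseteq> Q" using u0 insert.prems(2) by (auto simp: W_def)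
  then obtain u d where u: "u \<in> W" "u \<notin> N" "\<forall>i\<in>J. X i u - d i *\<^sub>R u \<in> N"
    using insert.IH[OF sW _ stW] by blast
  have "\<forall>i\<in>insert j J. X i u - (d(j := c)) i *\<^sub>R u \<in> N"
    using u insert.hyps by (auto simp: W_def)
  with u show ?case unfolding W_def by blast
qed

text \<open>A \<open>B\<close>-orthonormal family of joint eigenvectors \<open>e l\<close>, where \<open>c l i\<close> is the eigenvalue of \<open>X i\<close>
  at \<open>e l\<close>; the point with coordinates \<open>c l\<close> later becomes an atom.\<close>
definition eigensystem :: "nat \<Rightarrow> (nat \<Rightarrow> 'v) \<Rightarrow> (nat \<Rightarrow> 'i \<Rightarrow> real) \<Rightarrow> bool" where
  "eigensystem s e c \<longleftrightarrow> (\<forall>l\<in>{1..s}. e l \<in> Q \<and> (\<forall>i. X i (e l) - c l i *\<^sub>R e l \<in> N)) \<and>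
     (\<forall>l\<in>{1..s}. \<forall>l'\<in>{1..s}. B (e l) (e l') = (if l = l' then 1 else 0))"

lemma eigensystem_bound: assumes "eigensystem s e c" shows "s \<le> card S"
proof -
  have on: "B (e l) (e l') = (if l = l' then 1 else 0)" if "l \<in> {1..s}" "l' \<in> {1..s}" for l l'
    using assms that by (auto simp: eigensystem_def)
  have inj: "inj_on e {1..s}" by (rule inj_onI) (metis on zero_neq_one)
  have "independent (e ` {1..s})"
  proof (rule independent_if_scalars_zero)
    fix f x assume 0: "(\<Sum>x\<in>e ` {1..s}. f x *\<^sub>R x) = 0" and "x \<in> e ` {1..s}"
    then obtain l where l: "l \<in> {1..s}" "x = e l" by auto
    have "(\<Sum>l\<in>{1..s}. f (e l) *\<^sub>R e l) = 0"
      using 0 by (simp add: sum.reindex[OF inj] del: One_nat_def)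
    then have "0 = B (\<Sum>l\<in>{1..s}. f (e l) *\<^sub>R e l) (e l)"
      by (simp only: linear_0[OF linear_B])
    also have "\<dots> = (\<Sum>l'\<in>{1..s}. f (e l') * (if l' = l then 1 else 0))"
      unfolding B_simps by (rule sum.cong) (use l on in \<open>auto simp: B_simps\<close>)
    also have "\<dots> = f (e l)" using l by (simp add: if_distrib cong: if_cong)
    finally show "f x = 0" using l by simp
  qed simp
  moreover have "e ` {1..s} \<subseteq> span S"
    using assms Q_sub_P P_span by (auto simp: eigensystem_def)
  ultimately show ?thesis using independent_span_bound[OF finite_S] card_image[OF inj] by fastforce
qed

text \<open>As long as some \<open>f\<close> is not represented by its Fourier expansion, the orthogonal complement \<open>U\<close>
  of the family in \<open>Q\<close> is not contained in the kernel. It is stable because the operators are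
  self-adjoint, so it contains a further joint eigenvector.\<close>
lemma eigensystem_extend:
  assumes fin: "finite (UNIV :: 'i set)"
    and es: "eigensystem s e c"
    and f: "f \<in> P" "f - (\<Sum>l=1..s. B f (e l) *\<^sub>R e l) \<notin> N"
  shows "\<exists>e c. eigensystem (Suc s) e c"
proof -
  have eQ: "e l \<in> Q" and ev: "X i (e l) - c l i *\<^sub>R e l \<in> N" if "l \<in> {1..s}" for l i
    using es that by (auto simp: eigensystem_def)
  have on: "B (e l) (e l') = (if l = l' then 1 else 0)" if "l \<in> {1..s}" "l' \<in> {1..s}" for l l'
    using es that by (auto simp: eigensystem_def)
  have eP: "e l \<in> P" if "l \<in> {1..s}" for l using eQ[OF that] Q_sub_P by auto
  define U where "U = {u \<in> Q. \<forall>l\<in>{1..s}. B u (e l) = 0}"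
  have sU: "subspace U"
    using subspace_Q by (auto simp: subspace_def U_def B_simps)
  have st: "stable U i" for i
    unfolding stable_def
  proof
    fix u assume "u \<in> U"
    then have u: "u \<in> Q" "\<And>l. l \<in> {1..s} \<Longrightarrow> B u (e l) = 0" by (auto simp: U_def)
    obtain u' where u': "u' \<in> Q" "X i u - u' \<in> N" using flat_N[OF X_Q[OF u(1)]] .
    have "B u' (e l) = 0" if l: "l \<in> {1..s}" for l
    proof -
      have "u \<in> P" using u(1) Q_sub_P by auto
      have "B u' (e l) = B (X i u) (e l)" by (rule B_cong_N[OF u'(2) eP[OF l], symmetric])
      also have "\<dots> = B (X i (e l)) u" by (metis X_adj sym)
      also have "\<dots> = c l i * B (e l) u" by (simp add: B_cong_N[OF ev[OF l] \<open>u \<in> P\<close>] B_simps)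
      finally show ?thesis using u(2)[OF l] by (simp add: sym)
    qed
    with u' show "\<exists>u'\<in>U. X i u - u' \<in> N" by (auto simp: U_def)
  qed
  have "\<not> U \<subseteq> N"
  proof
    assume UN: "U \<subseteq> N"
    obtain q where q: "q \<in> Q" "f - q \<in> N" using flat_N[OF f(1)] .
    have fq: "B f (e l) = B q (e l)" if "l \<in> {1..s}" for l
      by (rule B_cong_N[OF q(2) eP[OF that]])
    have "q - (\<Sum>l=1..s. B q (e l) *\<^sub>R e l) \<in> U"
    proof -
      have "B (q - (\<Sum>l=1..s. B q (e l) *\<^sub>R e l)) (e l) = 0" if l: "l \<in> {1..s}" for l
      proof -
        have "B (\<Sum>l=1..s. B q (e l) *\<^sub>R e l) (e l) = (\<Sum>l'=1..s. B q (e l') * (if l' = l then 1 else 0))"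
          unfolding B_simps by (rule sum.cong) (use l on in \<open>auto simp: B_simps\<close>)
        then show ?thesis using l by (simp add: B_simps if_distrib cong: if_cong)
      qed
      then show ?thesis
        using q eQ by (auto simp: U_def intro!: subspace_diff[OF subspace_Q] subspace_sum[OF subspace_Q] subspace_scale[OF subspace_Q])
    qed
    then have "q - (\<Sum>l=1..s. B f (e l) *\<^sub>R e l) \<in> N" using UN fq by auto
    with N_trans[OF q(2)] f(2) show False by blast
  qed
  moreover have "U \<subseteq> Q" by (auto simp: U_def)
  ultimately obtain u b where u: "u \<in> U" "u \<notin> N" "\<And>i. X i u - b i *\<^sub>R u \<in> N"
    using common_eigenvector[OF fin sU _ st] by blast
  have uQ: "u \<in> Q" and uo: "\<And>l. l \<in> {1..s} \<Longrightarrow> B u (e l) = 0" using u(1) by (auto simp: U_def)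
  have pos: "0 < B u u" using pos_if_not_N uQ u(2) Q_sub_P by auto
  define n where "n = (1 / sqrt (B u u)) *\<^sub>R u"
  have "B n n = 1" using pos by (simp add: n_def B_simps B_simps2 power2_eq_square[symmetric] divide_simps)
  moreover have "X i n - b i *\<^sub>R n \<in> N" for i
    using subspace_scale[OF subspace_N u(3)[of i], of "1 / sqrt (B u u)"]
    by (simp add: n_def linear_scale[OF linear_X] scaleR_diff_right mult.commute)
  moreover have "n \<in> Q" using uQ subspace_scale[OF subspace_Q] by (simp add: n_def)
  moreover have "B n (e l) = 0" "B (e l) n = 0" if "l \<in> {1..s}" for l
    using uo[OF that] by (simp_all add: n_def B_simps B_simps2 sym[of "e l"])
  ultimately have "eigensystem (Suc s) (e(Suc s := n)) (c(Suc s := b))"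
    using eQ ev on by (auto simp: eigensystem_def le_Suc_eq)
  then show ?thesis by blast
qed

lemma eigenbasis:
  assumes fin: "finite (UNIV :: 'i set)"
  obtains s e c where "eigensystem s e c" "\<And>f. f \<in> P \<Longrightarrow> f - (\<Sum>l=1..s. B f (e l) *\<^sub>R e l) \<in> N"
proof -
  have ex: "\<exists>e c. eigensystem 0 e c" by (simp add: eigensystem_def)
  have "\<exists>s. (\<exists>e c. eigensystem s e c) \<and> (\<forall>s'. (\<exists>e c. eigensystem s' e c) \<longrightarrow> s' \<le> s)"
    using Nat.ex_has_greatest_nat[of "\<lambda>s. \<exists>e c. eigensystem s e c" 0 "card S"] ex eigensystem_bound by blast
  then obtain s e c where s: "eigensystem s e c" "\<not> (\<exists>e c. eigensystem (Suc s) e c)"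
    by (metis Suc_n_not_le_n)
  show ?thesis
  proof (rule that[OF s(1)])
    fix f assume "f \<in> P"
    then show "f - (\<Sum>l=1..s. B f (e l) *\<^sub>R e l) \<in> N"
      using eigensystem_extend[OF fin s(1)] s(2) by blast
  qed
qed

end

section \<open>Real polynomials in several variables\<close>

definition mon :: "'n::finite mindex \<Rightarrow> 'n mpoly" where
  "mon \<alpha> = Poly_Mapping.single \<alpha> 1"

definition polys :: "nat \<Rightarrow> 'n::finite mpoly set" where
  "polys k = {f. Poly_Mapping.keys f \<subseteq> mindices k}"

lemma lookup_scaleR [simp]:
  "Poly_Mapping.lookup (c *\<^sub>R f) \<alpha> = c * Poly_Mapping.lookup (f :: 'a \<Rightarrow>\<^sub>0 real) \<alpha>"
proof -
  have "finite {i. c * Poly_Mapping.lookup f i \<noteq> 0}"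
    by (rule finite_subset[OF _ finite_lookup[of f]]) auto
  then show ?thesis by (simp add: scaleR_poly_mapping_def)
qed

lemma scaleR_eq_mult: "c *\<^sub>R (f :: 'n::finite mpoly) = Poly_Mapping.single 0 c * f"
  by (rule poly_mapping_eqI) (simp add: mult_map_scale_conv_mult[symmetric] Poly_Mapping.map.rep_eq when_def)

lemma scaleR_mult_left: "(c *\<^sub>R f) * g = c *\<^sub>R (f * (g :: 'n::finite mpoly))"
  and scaleR_mult_right: "f * (c *\<^sub>R g) = c *\<^sub>R (f * (g :: 'n::finite mpoly))"
  by (simp_all add: scaleR_eq_mult mult_ac)

lemma linear_times: "linear (\<lambda>g. f * (g :: 'n::finite mpoly))"
  by (rule linearI) (simp_all add: distrib_left scaleR_mult_right)

lemma mon_mult: "mon \<alpha> * mon \<beta> = mon (\<alpha> + \<beta>)"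
  by (simp add: mon_def mult_single)

lemma mon_0: "mon 0 = 1"
  by (simp add: mon_def)

lemma lookup_mon: "Poly_Mapping.lookup (mon \<alpha>) \<beta> = (if \<alpha> = \<beta> then 1 else 0)"
  by (simp add: mon_def lookup_single when_def)

lemma mabs_add: "mabs (\<alpha> + \<beta>) = mabs \<alpha> + mabs \<beta>"
  by (simp add: mabs_def lookup_add sum.distrib)

lemma mabs_0 [simp]: "mabs 0 = 0"
  by (simp add: mabs_def)

lemma mabs_single [simp]: "mabs (Poly_Mapping.single i n) = n"
  by (simp add: mabs_def lookup_single when_def)

lemma finite_mindices [simp]: "finite (mindices k)"
proof -
  have "Poly_Mapping.lookup \<alpha> i \<le> mabs \<alpha>" for \<alpha> :: "'a mindex" and i
    unfolding mabs_def by (rule member_le_sum) simp_all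
  then have "Poly_Mapping.lookup ` mindices k \<subseteq> (UNIV :: 'a set) \<rightarrow>\<^sub>E {..k}"
    by (fastforce simp: mindices_def intro: order_trans)
  then have "finite (Poly_Mapping.lookup ` (mindices k :: 'a mindex set))"
    by (rule finite_subset) (simp add: finite_PiE)
  then show ?thesis by (rule finite_imageD) (simp add: inj_on_def)
qed

lemma zero_in_mindices [simp]: "0 \<in> mindices k"
  by (simp add: mindices_def)

lemma mindices_mono: "k \<le> l \<Longrightarrow> mindices k \<subseteq> mindices l"
  by (auto simp: mindices_def)

lemma mindices_add: "\<alpha> \<in> mindices k \<Longrightarrow> \<beta> \<in> mindices l \<Longrightarrow> \<alpha> + \<beta> \<in> mindices (k + l)"
  by (simp add: mindices_def mabs_add)

text \<open>Induction on the degree: a nonconstant monomial has a coordinate as a factor.\<close>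
lemma mindex_decompose:
  assumes "\<alpha> \<noteq> (0 :: 'n::finite mindex)"
  obtains i \<alpha>' where "\<alpha> = Poly_Mapping.single i 1 + \<alpha>'" "mabs \<alpha> = Suc (mabs \<alpha>')"
proof -
  obtain i where i: "Poly_Mapping.lookup \<alpha> i \<noteq> 0"
    using assms by (metis lookup_zero poly_mapping_eqI)
  have "\<alpha> = Poly_Mapping.single i 1 + (\<alpha> - Poly_Mapping.single i 1)"
    by (rule poly_mapping_eqI) (use i in \<open>auto simp: lookup_add lookup_minus lookup_single when_def\<close>)
  with that show ?thesis by (metis mabs_add mabs_single plus_1_eq_Suc)
qed

lemma mindices_split:
  assumes "\<alpha> \<in> mindices (k + l)"
  obtains \<beta> \<gamma> where "\<beta> \<in> mindices k" "\<gamma> \<in> mindices l" "\<alpha> = \<beta> + \<gamma>"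
proof -
  have "\<exists>\<beta> \<gamma>. mabs \<beta> \<le> k \<and> mabs \<gamma> \<le> l \<and> \<alpha> = \<beta> + \<gamma>" if "mabs \<alpha> \<le> k + l" for \<alpha> :: "'a mindex"
    using that
  proof (induction k arbitrary: \<alpha>)
    case 0
    then show ?case by (intro exI[of _ 0] exI[of _ \<alpha>]) simp
  next
    case (Suc k)
    show ?case
    proof (cases "\<alpha> = 0")
      case True
      then show ?thesis by (intro exI[of _ 0]) simp
    next
      case False
      then obtain i \<alpha>' where a: "\<alpha> = Poly_Mapping.single i 1 + \<alpha>'" "mabs \<alpha> = Suc (mabs \<alpha>')"
        by (rule mindex_decompose)
      then obtain \<beta> \<gamma> where "mabs \<beta> \<le> k" "mabs \<gamma> \<le> l" "\<alpha>' = \<beta> + \<gamma>"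
        using Suc by force
      then show ?thesis
        using a by (intro exI[of _ "Poly_Mapping.single i 1 + \<beta>"] exI[of _ \<gamma>]) (simp add: mabs_add add.assoc)
    qed
  qed
  then show ?thesis using assms that by (auto simp: mindices_def)
qed

lemma poly_sum_superset:
  assumes "finite A" "Poly_Mapping.keys f \<subseteq> A"
  shows "f = (\<Sum>\<alpha>\<in>A. Poly_Mapping.lookup f \<alpha> *\<^sub>R mon \<alpha>)"
proof (rule poly_mapping_eqI)
  fix \<beta>
  have "Poly_Mapping.lookup f \<beta> = 0" if "\<beta> \<notin> A" using assms that by (auto simp: in_keys_iff)
  then show "Poly_Mapping.lookup f \<beta> = Poly_Mapping.lookup (\<Sum>\<alpha>\<in>A. Poly_Mapping.lookup f \<alpha> *\<^sub>R mon \<alpha>) \<beta>"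
    using assms(1) by (simp add: lookup_sum lookup_mon mult_delta_right)
qed

lemma poly_sum: "f \<in> polys k \<Longrightarrow> f = (\<Sum>\<alpha>\<in>mindices k. Poly_Mapping.lookup f \<alpha> *\<^sub>R mon \<alpha>)"
  by (rule poly_sum_superset) (simp_all add: polys_def)

lemma subspace_polys: "subspace (polys k)"
proof -
  have "polys k = {f. \<forall>\<alpha>. \<alpha> \<notin> mindices k \<longrightarrow> Poly_Mapping.lookup f \<alpha> = 0}"
    by (auto simp: polys_def in_keys_iff)
  then show ?thesis by (auto simp: subspace_def lookup_add)
qed

lemma mon_in_polys: "mon \<alpha> \<in> polys k \<longleftrightarrow> \<alpha> \<in> mindices k"
  by (simp add: polys_def mon_def)

lemma polys_eq_span: "(polys k :: 'n::finite mpoly set) = span (mon ` mindices k)"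
proof
  show "span (mon ` mindices k) \<subseteq> polys k"
    by (rule span_minimal[OF _ subspace_polys]) (auto simp: mon_in_polys)
  have "f \<in> span (mon ` mindices k)" if f: "f \<in> polys k" for f :: "'n mpoly"
  proof -
    have "(\<Sum>\<alpha>\<in>mindices k. Poly_Mapping.lookup f \<alpha> *\<^sub>R mon \<alpha>) \<in> span (mon ` mindices k)"
      by (intro span_sum span_scale span_base imageI)
    then show ?thesis using poly_sum[OF f] by simp
  qed
  then show "polys k \<subseteq> span (mon ` mindices k :: 'n mpoly set)" by blast
qed

lemma polys_subset: "k \<le> l \<Longrightarrow> polys k \<subseteq> polys l"
  using mindices_mono by (fastforce simp: polys_def)

lemma polys_mult: "f \<in> polys k \<Longrightarrow> g \<in> polys l \<Longrightarrow> f * g \<in> polys (k + l)"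
  using keys_mult[of f g] unfolding polys_def by (blast intro: mindices_add)

lemma polys_half_deg: "q \<in> polys (2 * half_deg q)"
proof -
  have "mabs \<alpha> \<le> tdeg q" if "\<alpha> \<in> Poly_Mapping.keys q" for \<alpha>
    using that by (auto simp: tdeg_def intro!: Max_ge)
  moreover have "tdeg q \<le> 2 * half_deg q"
    unfolding half_deg_def by linarith
  ultimately show ?thesis by (force simp: polys_def mindices_def)
qed

text \<open>Links linear functionals on products of polynomials with the matrices of the relaxation: the
  right-hand side is the bilinear form of the matrix \<open>L (x\<^sup>\<alpha> * x\<^sup>\<beta>)\<close> at the coefficient vectors.\<close>
lemma linear_mult_expand:
  fixes L :: "'n::finite mpoly \<Rightarrow> real"
  assumes L: "linear L" and f: "f \<in> polys k" and g: "g \<in> polys l"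
  shows "L (f * g) = (\<Sum>\<alpha>\<in>mindices k. \<Sum>\<beta>\<in>mindices l.
    Poly_Mapping.lookup f \<alpha> * L (mon \<alpha> * mon \<beta>) * Poly_Mapping.lookup g \<beta>)"
proof -
  have "f * g = (\<Sum>\<alpha>\<in>mindices k. Poly_Mapping.lookup f \<alpha> *\<^sub>R mon \<alpha>)
     * (\<Sum>\<beta>\<in>mindices l. Poly_Mapping.lookup g \<beta> *\<^sub>R mon \<beta>)"
    using poly_sum[OF f] poly_sum[OF g] by simp
  then show ?thesis
    by (simp add: sum_product linear_sum[OF L] scaleR_mult_left scaleR_mult_right linear_scale[OF L] mult_ac)
qed

section \<open>The Riesz functional and localizing matrices\<close>

lemma riesz_superset:
  assumes "finite A" "Poly_Mapping.keys q \<subseteq> A"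
  shows "riesz q y = (\<Sum>\<alpha>\<in>A. Poly_Mapping.lookup q \<alpha> * y \<alpha>)"
  unfolding riesz_def using assms by (intro sum.mono_neutral_left) (auto simp: in_keys_iff)

lemma linear_riesz: "linear (\<lambda>q. riesz q y)"
proof (rule linearI)
  fix f g :: "'a mpoly" and c :: real
  have fin: "finite (Poly_Mapping.keys f \<union> Poly_Mapping.keys g)" by simp
  show "riesz (f + g) y = riesz f y + riesz g y"
    unfolding riesz_superset[OF fin keys_add] riesz_superset[OF fin Un_upper1] riesz_superset[OF fin Un_upper2]
    by (simp add: lookup_add distrib_right sum.distrib)
  have "Poly_Mapping.keys (c *\<^sub>R f) \<subseteq> Poly_Mapping.keys f" by (auto simp: in_keys_iff)
  from riesz_superset[OF finite_keys this, of y]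
  show "riesz (c *\<^sub>R f) y = c *\<^sub>R riesz f y"
    by (simp add: riesz_def sum_distrib_left mult.assoc)
qed

lemma riesz_mon [simp]: "riesz (mon \<alpha>) y = y \<alpha>"
  by (simp add: riesz_def mon_def)

lemma riesz_cong: "q \<in> polys k \<Longrightarrow> (\<And>\<alpha>. \<alpha> \<in> mindices k \<Longrightarrow> y \<alpha> = z \<alpha>) \<Longrightarrow> riesz q y = riesz q z"
  unfolding riesz_def polys_def by (intro sum.cong) auto

lemma linear_riesz_times: "linear (\<lambda>f. riesz (q * f) y)"
  using linear_compose[OF linear_times[of q] linear_riesz[of y]] by (simp add: o_def)

lemma peval_eq_riesz: "peval q x = riesz q (mpower x)"
  by (simp add: peval_def riesz_def)

lemma mpower_add: "mpower x (\<alpha> + \<beta>) = mpower x \<alpha> * mpower x \<beta>"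
  by (simp add: mpower_def lookup_add power_add prod.distrib)

lemma mpower_0 [simp]: "mpower x 0 = 1"
  by (simp add: mpower_def)

lemma mpower_single: "mpower x (Poly_Mapping.single i 1) = x $ i"
proof -
  have "mpower x (Poly_Mapping.single i 1) = (\<Prod>j\<in>UNIV. if j = i then x $ j else 1)"
    unfolding mpower_def by (rule prod.cong) (auto simp: lookup_single when_def)
  then show ?thesis by simp
qed

lemma peval_mon [simp]: "peval (mon \<alpha>) x = mpower x \<alpha>"
  by (simp add: peval_eq_riesz)

lemma polys_exhaust: "\<exists>k. f \<in> polys k"
  using polys_half_deg by blast

lemma peval_mult: "peval (f * g) x = peval f x * peval g x"
proof -
  obtain k l where k: "f \<in> polys k" and l: "g \<in> polys l" using polys_exhaust by meson
  have "peval f x = (\<Sum>\<alpha>\<in>mindices k. Poly_Mapping.lookup f \<alpha> * mpower x \<alpha>)"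
    "peval g x = (\<Sum>\<alpha>\<in>mindices l. Poly_Mapping.lookup g \<alpha> * mpower x \<alpha>)"
    using k l by (auto simp: peval_eq_riesz polys_def intro!: riesz_superset)
  then show ?thesis
    using linear_mult_expand[OF linear_riesz k l, of "mpower x"]
    by (simp add: peval_eq_riesz mon_mult mpower_add sum_product mult_ac)
qed

lemma peval_scaleR: "peval (c *\<^sub>R f) x = c * peval f x"
  by (simp add: peval_eq_riesz linear_scale[OF linear_riesz])

lemma localizing_entry: "localizing_mat q y \<alpha> \<beta> = riesz (q * (mon \<alpha> * mon \<beta>)) y"
  by (simp add: localizing_mat_def mon_def mult.assoc)

lemma moment_eq_localizing: "moment_mat y = localizing_mat 1 y"
  by (intro ext) (simp add: moment_mat_def localizing_entry mon_mult)

text \<open>Positivity of localizing matrices without coordinates. With \<open>q = 1\<close> this covers moment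
  matrices.\<close>
lemma psd_localizing_iff:
  "mat_psd (mindices s) (localizing_mat q y) \<longleftrightarrow> (\<forall>f\<in>polys s. 0 \<le> riesz (q * (f * f)) y)"
proof
  assume "mat_psd (mindices s) (localizing_mat q y)"
  then have "0 \<le> (\<Sum>\<alpha>\<in>mindices s. \<Sum>\<beta>\<in>mindices s. u \<alpha> * localizing_mat q y \<alpha> \<beta> * u \<beta>)" for u
    by (auto simp: mat_psd_def)
  then show "\<forall>f\<in>polys s. 0 \<le> riesz (q * (f * f)) y"
    using linear_mult_expand[OF linear_riesz_times, of _ s _ s q y] by (simp add: localizing_entry)
next
  assume pos: "\<forall>f\<in>polys s. 0 \<le> riesz (q * (f * f)) y"
  have "0 \<le> (\<Sum>\<alpha>\<in>mindices s. \<Sum>\<beta>\<in>mindices s. u \<alpha> * localizing_mat q y \<alpha> \<beta> * u \<beta>)" for u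
  proof -
    define f where "f = (\<Sum>\<alpha>\<in>mindices s. u \<alpha> *\<^sub>R mon \<alpha> :: 'a mpoly)"
    have f: "f \<in> polys s" unfolding f_def
      by (intro subspace_sum[OF subspace_polys] subspace_scale[OF subspace_polys]) (simp add: mon_in_polys)
    have lf: "Poly_Mapping.lookup f \<alpha> = u \<alpha>" if "\<alpha> \<in> mindices s" for \<alpha>
      using that by (simp add: f_def lookup_sum lookup_mon mult_delta_right)
    have "0 \<le> riesz (q * (f * f)) y" using pos f by blast
    then show ?thesis
      by (simp add: linear_mult_expand[OF linear_riesz_times f f] localizing_entry lf)
  qed
  moreover have "localizing_mat q y \<alpha> \<beta> = localizing_mat q y \<beta> \<alpha>" for \<alpha> \<beta>
    by (simp add: localizing_entry mult_ac)
  ultimately show "mat_psd (mindices s) (localizing_mat q y)"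
    by (auto simp: mat_psd_def)
qed

lemma zero_localizing_iff:
  "mat_zero (mindices s) (localizing_mat q y) \<longleftrightarrow> (\<forall>f\<in>polys s. \<forall>g\<in>polys s. riesz (q * (f * g)) y = 0)"
  (is "?l \<longleftrightarrow> ?r")
proof
  assume ?l then show ?r
    using linear_mult_expand[OF linear_riesz_times, of _ s _ s q y]
    by (simp add: localizing_entry mat_zero_def)
next
  assume ?r then show ?l
    by (simp add: mat_zero_def localizing_entry mon_in_polys)
qed

section \<open>Flatness as reduction of degree\<close>

definition matrix_col :: "'i set \<Rightarrow> ('i \<Rightarrow> 'i \<Rightarrow> real) \<Rightarrow> 'i \<Rightarrow> ('i \<Rightarrow>\<^sub>0 real)" where
  "matrix_col I A \<beta> = (\<Sum>\<alpha>\<in>I. Poly_Mapping.single \<alpha> (A \<alpha> \<beta>))"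

lemma mat_rank_eq_dim_cols: "mat_rank I A = dim (matrix_col I A ` I)"
  by (simp add: mat_rank_def matrix_col_def)

lemma lookup_matrix_col: "finite I \<Longrightarrow> Poly_Mapping.lookup (matrix_col I A \<beta>) \<alpha> = (if \<alpha> \<in> I then A \<alpha> \<beta> else 0)"
  by (simp add: matrix_col_def lookup_sum lookup_single when_def)

lemma independent_card_le_dim_finite:
  assumes "finite V" "B \<subseteq> V" "independent (B :: 'v::real_vector set)" shows "card B \<le> dim V"
proof -
  obtain C where C: "C \<subseteq> V" "independent C" "V \<subseteq> span C" "card C = dim V" by (rule basis_exists)
  have "B \<subseteq> span C" "finite C" using assms C finite_subset by blast+
  with independent_span_bound[of C B] assms C show ?thesis by simp
qed

text \<open>If a matrix has the same rank as a principal submatrix, then the columns indexed by the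
  submatrix span all columns: restricting rows is linear, so those columns already have at least
  the rank of the submatrix, and one more independent column would exceed the rank of the whole.\<close>
lemma cols_in_span_if_rank_eq:
  assumes I: "finite I" and J: "J \<subseteq> I" and rk: "mat_rank I A = mat_rank J A" and \<beta>: "\<beta> \<in> I"
  shows "matrix_col I A \<beta> \<in> span (matrix_col I A ` J)"
proof (rule ccontr)
  assume n: "matrix_col I A \<beta> \<notin> span (matrix_col I A ` J)"
  have fJ: "finite J" using I J finite_subset by blast
  obtain C where C: "C \<subseteq> matrix_col I A ` J" "independent C" "matrix_col I A ` J \<subseteq> span C"
    using maximal_independent_subset by blast
  have fC: "finite C" using C(1) fJ finite_subset by blast
  have n': "matrix_col I A \<beta> \<notin> span C" using n span_mono[OF C(1)] by auto
  \<comment> \<open>Restriction of a column to the rows in \<open>J\<close>.\<close>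
  define \<rho> where "\<rho> z = (\<Sum>\<alpha>\<in>J. Poly_Mapping.single \<alpha> (Poly_Mapping.lookup z \<alpha>))" for z :: "'a \<Rightarrow>\<^sub>0 real"
  have lr: "Poly_Mapping.lookup (\<rho> z) \<alpha> = (if \<alpha> \<in> J then Poly_Mapping.lookup z \<alpha> else 0)" for z \<alpha>
    using fJ by (simp add: \<rho>_def lookup_sum lookup_single when_def)
  have lin: "linear \<rho>"
    by (rule linearI; rule poly_mapping_eqI) (simp_all add: lr lookup_add)
  have "matrix_col J A \<gamma> = \<rho> (matrix_col I A \<gamma>)" for \<gamma>
    by (rule poly_mapping_eqI) (use J in \<open>auto simp: lr lookup_matrix_col I fJ\<close>)
  then have "matrix_col J A ` J = \<rho> ` matrix_col I A ` J" by (simp add: image_image)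
  also have "\<dots> \<subseteq> span (\<rho> ` C)" using C(3) linear_span_image[OF lin] by blast
  finally have "mat_rank J A \<le> card (\<rho> ` C)"
    unfolding mat_rank_eq_dim_cols using fC by (intro dim_le_card) auto
  also have "\<dots> \<le> card C" using fC by (rule card_image_le)
  also have "\<dots> < card (insert (matrix_col I A \<beta>) C)"
    using n' fC span_base by (metis card_insert_disjoint lessI)
  also have "\<dots> \<le> mat_rank I A"
    unfolding mat_rank_eq_dim_cols
  proof (rule independent_card_le_dim_finite)
    show "insert (matrix_col I A \<beta>) C \<subseteq> matrix_col I A ` I" using C(1) J \<beta> by auto
    show "independent (insert (matrix_col I A \<beta>) C)" using n' C(2) by (simp add: independent_insert)
  qed (use I in simp)
  finally show False using rk by simp
qed

text \<open>The moment matrix of order \<open>t\<close> applied to the coefficient vector of \<open>f\<close>. Its kernel on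
  \<open>polys t\<close> is the kernel of the form \<open>(f, g) \<mapsto> riesz (f * g) y\<close>.\<close>
definition moment_col :: "nat \<Rightarrow> ('n::finite mindex \<Rightarrow> real) \<Rightarrow> 'n mpoly \<Rightarrow> ('n mindex \<Rightarrow>\<^sub>0 real)" where
  "moment_col t y f = (\<Sum>\<alpha>\<in>mindices t. riesz (f * mon \<alpha>) y *\<^sub>R mon \<alpha>)"

lemma linear_moment_col: "linear (moment_col t y)"
proof (rule linearI)
  have r: "riesz (f * mon \<alpha>) y = riesz (mon \<alpha> * f) y" for f \<alpha> by (simp add: mult.commute)
  show "moment_col t y (f + g) = moment_col t y f + moment_col t y g" for f g
    by (simp add: moment_col_def r linear_add[OF linear_riesz_times] scaleR_add_left sum.distrib)
  show "moment_col t y (c *\<^sub>R f) = c *\<^sub>R moment_col t y f" for c f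
    by (simp add: moment_col_def r linear_scale[OF linear_riesz_times] scaleR_sum_right)
qed

lemma moment_col_mon: "moment_col t y (mon \<beta>) = matrix_col (mindices t) (moment_mat y) \<beta>"
  by (rule poly_mapping_eqI)
    (simp add: moment_col_def matrix_col_def moment_mat_def lookup_sum lookup_mon lookup_single when_def
      mon_mult add.commute mult_delta_right)

lemma lookup_moment_col:
  "\<alpha> \<in> mindices t \<Longrightarrow> Poly_Mapping.lookup (moment_col t y f) \<alpha> = riesz (f * mon \<alpha>) y"
  by (simp add: moment_col_def lookup_sum lookup_mon mult_delta_right)

lemma moment_col_pairing:
  assumes "g \<in> polys t"
  shows "riesz (f * g) y = (\<Sum>\<alpha>\<in>mindices t. Poly_Mapping.lookup g \<alpha> * Poly_Mapping.lookup (moment_col t y f) \<alpha>)"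
proof -
  have "riesz (f * g) y = riesz (f * (\<Sum>\<alpha>\<in>mindices t. Poly_Mapping.lookup g \<alpha> *\<^sub>R mon \<alpha>)) y"
    using poly_sum[OF assms] by simp
  then show ?thesis
    by (simp add: linear_sum[OF linear_riesz_times] linear_scale[OF linear_riesz_times] lookup_moment_col)
qed

lemma moment_col_eq_iff:
  "moment_col t y f = moment_col t y g \<longleftrightarrow> (\<forall>h\<in>polys t. riesz (f * h) y = riesz (g * h) y)"
proof
  assume "moment_col t y f = moment_col t y g"
  then show "\<forall>h\<in>polys t. riesz (f * h) y = riesz (g * h) y"
    by (simp add: moment_col_pairing)
next
  assume "\<forall>h\<in>polys t. riesz (f * h) y = riesz (g * h) y"
  then show "moment_col t y f = moment_col t y g"
    by (simp add: moment_col_def mon_in_polys)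
qed

lemma moment_rank_eq_dim: "mat_rank (mindices t) (moment_mat y) = dim (moment_col t y ` polys t)"
proof -
  have "moment_col t y ` polys t = span (matrix_col (mindices t) (moment_mat y) ` mindices t)"
    unfolding polys_eq_span linear_span_image[OF linear_moment_col, symmetric]
    by (simp add: image_image moment_col_mon)
  then show ?thesis by (simp add: mat_rank_eq_dim_cols)
qed

text \<open>The form in which the rank condition is used: modulo the kernel of the moment matrix, every
  polynomial of degree at most \<open>t\<close> has a representative of degree at most \<open>s\<close>.\<close>
lemma flat_reduction:
  assumes "s \<le> t" "mat_rank (mindices t) (moment_mat y) = mat_rank (mindices s) (moment_mat y)"
    and f: "f \<in> polys t"
  obtains q where "q \<in> polys s" "\<And>g. g \<in> polys t \<Longrightarrow> riesz (f * g) y = riesz (q * g) y"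
proof -
  let ?c = "matrix_col (mindices t) (moment_mat y)"
  have img: "moment_col t y ` polys k = span (?c ` mindices k)" for k
    unfolding polys_eq_span linear_span_image[OF linear_moment_col, symmetric]
    by (simp add: image_image moment_col_mon)
  have "?c ` mindices t \<subseteq> span (?c ` mindices s)"
    using cols_in_span_if_rank_eq[OF finite_mindices mindices_mono assms(2)] assms(1) by blast
  then have "moment_col t y ` polys t \<subseteq> moment_col t y ` polys s"
    unfolding img by (rule span_minimal) simp
  with f obtain q where "q \<in> polys s" "moment_col t y f = moment_col t y q" by blast
  with that show ?thesis by (auto simp: moment_col_eq_iff)
qed

section \<open>Quadrature from a flat truncation\<close>

text \<open>A positive functional with a flat truncation is a quadrature rule. Let \<open>e\<^sub>1, \<dots>, e\<^sub>s\<close> be an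
  orthonormal basis of joint eigenvectors and \<open>v\<^sub>l\<close> the point formed by the eigenvalues of \<open>e\<^sub>l\<close>. Moving
  the factors of a monomial onto \<open>e\<^sub>l\<close> one at a time gives \<open>L (f e\<^sub>l) = f (v\<^sub>l) L (e\<^sub>l)\<close>, and Parseval's
  identity \<open>L (f g) = \<Sum> L (f e\<^sub>l) L (g e\<^sub>l)\<close> becomes the quadrature rule with weights \<open>L (e\<^sub>l)\<^sup>2\<close>.
  Orthonormality reads \<open>e\<^sub>l (v\<^sub>k) L (e\<^sub>k) = \<delta>\<close>, so the weights are positive and the multiples
  \<open>h\<^sub>l = L (e\<^sub>l) e\<^sub>l\<close> interpolate at the nodes. These \<open>h\<^sub>l\<close> have degree at most \<open>t - d\<close>, which is
  what the localizing constraints need later.\<close>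
theorem flat_truncation_quadrature:
  fixes y :: "'n::finite mindex \<Rightarrow> real"
  assumes d: "1 \<le> d" "d \<le> t"
    and pos: "\<And>f. f \<in> polys t \<Longrightarrow> 0 \<le> riesz (f * f) y"
    and rk: "mat_rank (mindices t) (moment_mat y) = mat_rank (mindices (t - d)) (moment_mat y)"
    and r: "r = mat_rank (mindices t) (moment_mat y)"
  obtains v :: "nat \<Rightarrow> real ^ 'n" and lam :: "nat \<Rightarrow> real" and h :: "nat \<Rightarrow> 'n mpoly"
  where "\<And>l. l \<in> {1..r} \<Longrightarrow> 0 < lam l"
    and "\<And>l. l \<in> {1..r} \<Longrightarrow> h l \<in> polys (t - d)"
    and "\<And>l l'. l \<in> {1..r} \<Longrightarrow> l' \<in> {1..r} \<Longrightarrow> peval (h l) (v l') = (if l = l' then 1 else 0)"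
    and "\<And>q. q \<in> polys (2 * t) \<Longrightarrow> riesz q y = (\<Sum>l=1..r. lam l * peval q (v l))"
proof -
  let ?X = "\<lambda>i. mon (Poly_Mapping.single i 1) :: 'n mpoly"
  interpret flat_form "\<lambda>f g. riesz (f * g) y" "polys t" "polys (t - d)" "mon ` mindices t"
    "\<lambda>i f. ?X i * f"
  proof (rule flat_form.intro)
    show "linear (\<lambda>f. riesz (f * g) y)" for g
      using linear_riesz_times[of g y] by (simp add: mult.commute)
    show "polys (t - d) \<subseteq> (polys t :: 'n mpoly set)" by (rule polys_subset) simp
    show "polys t \<subseteq> span (mon ` mindices t :: 'n mpoly set)" by (simp add: polys_eq_span)
    show "\<exists>q\<in>polys (t - d). \<forall>g\<in>polys t. riesz ((f - q) * g) y = 0" if f: "f \<in> polys t" for f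
    proof -
      obtain q where "q \<in> polys (t - d)" "\<And>g. g \<in> polys t \<Longrightarrow> riesz (f * g) y = riesz (q * g) y"
        using flat_reduction[OF _ rk f] by auto
      then show ?thesis by (auto simp: left_diff_distrib linear_diff[OF linear_riesz])
    qed
    show "linear (\<lambda>f. ?X i * f)" for i by (rule linear_times)
    show "?X i * f \<in> polys t" if "f \<in> polys (t - d)" for i f
    proof -
      have "?X i \<in> polys d" using d by (simp add: mon_in_polys mindices_def)
      from polys_mult[OF this that] d show ?thesis by simp
    qed
  qed (simp_all add: subspace_polys pos mult_ac)
  obtain s e c where es: "eigensystem s e c"
    and exp: "\<And>f. f \<in> polys t \<Longrightarrow> f - (\<Sum>l=1..s. riesz (f * e l) y *\<^sub>R e l) \<in> N"
    by (rule eigenbasis) simp_all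
  have eQ: "e l \<in> polys (t - d)" and eX: "?X i * e l - c l i *\<^sub>R e l \<in> N" if "l \<in> {1..s}" for l i
    using es that unfolding eigensystem_def by blast+
  have on: "riesz (e l * e l') y = (if l = l' then 1 else 0)" if "l \<in> {1..s}" "l' \<in> {1..s}" for l l'
    using es that unfolding eigensystem_def by blast+
  have eP: "e l \<in> polys t" if "l \<in> {1..s}" for l using eQ[OF that] Q_sub_P by auto
  define v :: "nat \<Rightarrow> real ^ 'n" where "v l = (\<chi> i. c l i)" for l
  define a where "a l = riesz (e l) y" for l
  have ev_mon: "riesz (mon \<alpha> * e l) y = mpower (v l) \<alpha> * a l" if l: "l \<in> {1..s}" and "\<alpha> \<in> mindices t" for l \<alpha>
    using that(2)
  proof (induction "mabs \<alpha>" arbitrary: \<alpha>)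
    case 0
    then have "\<alpha> = 0" by (metis mindex_decompose nat.simps(3))
    then show ?case by (simp add: mon_0 a_def)
  next
    case (Suc n)
    then have "\<alpha> \<noteq> 0" by auto
    then obtain i \<beta> where b: "\<alpha> = Poly_Mapping.single i 1 + \<beta>" "mabs \<alpha> = Suc (mabs \<beta>)"
      by (rule mindex_decompose)
    then have bt: "\<beta> \<in> mindices t" and IH: "riesz (mon \<beta> * e l) y = mpower (v l) \<beta> * a l"
      using Suc by (auto simp: mindices_def)
    have "riesz (mon \<alpha> * e l) y = riesz ((?X i * e l) * mon \<beta>) y"
      by (simp add: b mon_mult[symmetric] mult_ac)
    also have "\<dots> = riesz ((c l i *\<^sub>R e l) * mon \<beta>) y"
      by (rule B_cong_N[OF eX[OF l]]) (simp add: mon_in_polys bt)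
    also have "\<dots> = c l i * riesz (mon \<beta> * e l) y"
      by (simp add: scaleR_mult_left linear_scale[OF linear_riesz] mult.commute[of "e l"])
    finally show ?case by (simp add: IH b mpower_add mpower_single v_def del: One_nat_def)
  qed
  have ev: "riesz (f * e l) y = peval f (v l) * a l" if l: "l \<in> {1..s}" and f: "f \<in> polys t" for f l
  proof -
    have "riesz (f * e l) y = riesz ((\<Sum>\<alpha>\<in>mindices t. Poly_Mapping.lookup f \<alpha> *\<^sub>R mon \<alpha>) * e l) y"
      using poly_sum[OF f] by simp
    also have "\<dots> = (\<Sum>\<alpha>\<in>mindices t. Poly_Mapping.lookup f \<alpha> * riesz (mon \<alpha> * e l) y)"
      by (simp add: sum_distrib_right scaleR_mult_left linear_sum[OF linear_riesz] linear_scale[OF linear_riesz])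
    also have "\<dots> = (\<Sum>\<alpha>\<in>mindices t. Poly_Mapping.lookup f \<alpha> * mpower (v l) \<alpha>) * a l"
      by (simp add: ev_mon[OF l] sum_distrib_right mult.assoc)
    also have "(\<Sum>\<alpha>\<in>mindices t. Poly_Mapping.lookup f \<alpha> * mpower (v l) \<alpha>) = peval f (v l)"
      using f unfolding peval_eq_riesz polys_def by (intro riesz_superset[symmetric]) auto
    finally show ?thesis .
  qed
  have node: "peval (e l) (v l') * a l' = (if l = l' then 1 else 0)" if "l \<in> {1..s}" "l' \<in> {1..s}" for l l'
    using on[OF that] ev[OF that(2) eP[OF that(1)]] by simp
  have y_expand: "y \<alpha> = (\<Sum>l=1..s. (a l)\<^sup>2 * mpower (v l) \<alpha>)" if \<alpha>: "\<alpha> \<in> mindices (2 * t)" for \<alpha>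
  proof -
    have "\<alpha> \<in> mindices (t + t)" using \<alpha> by (simp add: mult_2)
    then obtain \<beta> \<gamma> where bc: "\<beta> \<in> mindices t" "\<gamma> \<in> mindices t" "\<alpha> = \<beta> + \<gamma>"
      by (rule mindices_split)
    have P: "mon \<beta> \<in> polys t" "mon \<gamma> \<in> polys t" using bc by (simp_all add: mon_in_polys)
    have "y \<alpha> = riesz (mon \<beta> * mon \<gamma>) y" by (simp add: mon_mult bc)
    also have "\<dots> = riesz ((\<Sum>l=1..s. riesz (mon \<beta> * e l) y *\<^sub>R e l) * mon \<gamma>) y"
      by (rule B_cong_N[OF exp[OF P(1)] P(2)])
    also have "\<dots> = (\<Sum>l=1..s. riesz (mon \<beta> * e l) y * riesz (mon \<gamma> * e l) y)"
      by (simp add: sum_distrib_right scaleR_mult_left linear_sum[OF linear_riesz] linear_scale[OF linear_riesz]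
          mult.commute[of "e _" "mon \<gamma>"])
    also have "\<dots> = (\<Sum>l=1..s. (a l)\<^sup>2 * mpower (v l) \<alpha>)"
      by (rule sum.cong) (simp_all add: ev P bc(3) mpower_add power2_eq_square)
    finally show ?thesis .
  qed
  \<comment> \<open>The images of the eigenvectors form a basis of the column space of the moment matrix.\<close>
  have "s = r"
  proof -
    let ?c = "moment_col t y"
    have inj: "inj_on (\<lambda>l. ?c (e l)) {1..s}"
    proof (rule inj_onI)
      fix l l' assume l: "l \<in> {1..s}" "l' \<in> {1..s}" "?c (e l) = ?c (e l')"
      then have "riesz (e l * e l) y = riesz (e l' * e l) y" using eP by (simp add: moment_col_eq_iff)
      with on l show "l = l'" by (metis zero_neq_one)
    qed
    have "independent ((\<lambda>l. ?c (e l)) ` {1..s})"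
    proof (rule independent_if_scalars_zero)
      fix f x assume 0: "(\<Sum>x\<in>(\<lambda>l. ?c (e l)) ` {1..s}. f x *\<^sub>R x) = 0" and "x \<in> (\<lambda>l. ?c (e l)) ` {1..s}"
      then obtain l where l: "l \<in> {1..s}" "x = ?c (e l)" by auto
      define g where "g = (\<Sum>l\<in>{1..s}. f (?c (e l)) *\<^sub>R e l)"
      have "?c g = ?c 0"
        using 0 by (simp add: g_def sum.reindex[OF inj] linear_sum[OF linear_moment_col]
            linear_scale[OF linear_moment_col] linear_0[OF linear_moment_col] del: One_nat_def)
      then have "riesz (g * e l) y = 0"
        using eP[OF l(1)] by (simp add: moment_col_eq_iff linear_0[OF linear_riesz])
      moreover have "riesz (g * e l) y = (\<Sum>l'\<in>{1..s}. f (?c (e l')) * (if l' = l then 1 else 0))"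
        unfolding g_def sum_distrib_right linear_sum[OF linear_riesz]
        by (rule sum.cong) (use on l in \<open>auto simp: scaleR_mult_left linear_scale[OF linear_riesz]\<close>)
      ultimately show "f x = 0" using l by (simp add: if_distrib cong: if_cong)
    qed simp
    moreover have "(\<lambda>l. ?c (e l)) ` {1..s} \<subseteq> ?c ` polys t" using eP by auto
    moreover have "?c ` polys t \<subseteq> span ((\<lambda>l. ?c (e l)) ` {1..s})"
    proof
      fix z assume "z \<in> ?c ` polys t"
      then obtain f where f: "f \<in> polys t" "z = ?c f" by auto
      have "?c f = ?c (\<Sum>l=1..s. riesz (f * e l) y *\<^sub>R e l)"
        unfolding moment_col_eq_iff using B_cong_N[OF exp[OF f(1)]] by blast
      also have "\<dots> = (\<Sum>l=1..s. riesz (f * e l) y *\<^sub>R ?c (e l))"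
        by (simp add: linear_sum[OF linear_moment_col] linear_scale[OF linear_moment_col])
      also have "\<dots> \<in> span ((\<lambda>l. ?c (e l)) ` {1..s})"
        by (intro span_sum span_scale span_base) auto
      finally show "z \<in> span ((\<lambda>l. ?c (e l)) ` {1..s})" by (simp add: f)
    qed
    ultimately have "card ((\<lambda>l. ?c (e l)) ` {1..s}) = dim (?c ` polys t)"
      using basis_card_eq_dim by blast
    then show ?thesis unfolding r moment_rank_eq_dim card_image[OF inj] by simp
  qed
  define h where "h l = a l *\<^sub>R e l" for l
  show thesis
  proof (rule that[of "\<lambda>l. (a l)\<^sup>2" h v])
    have a_ne: "a l \<noteq> 0" if "l \<in> {1..s}" for l using node[OF that that] by auto
    show "0 < (a l)\<^sup>2" if "l \<in> {1..r}" for l using a_ne that \<open>s = r\<close> by simp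
    show "h l \<in> polys (t - d)" if "l \<in> {1..r}" for l
      using eQ[of l] that \<open>s = r\<close> by (auto simp: h_def intro!: subspace_scale[OF subspace_polys])
    show "peval (h l) (v l') = (if l = l' then 1 else 0)" if "l \<in> {1..r}" "l' \<in> {1..r}" for l l'
      using node[of l l'] a_ne[of l'] that \<open>s = r\<close>
      by (auto simp: h_def peval_scaleR mult.commute split: if_splits)
    show "riesz q y = (\<Sum>l=1..r. (a l)\<^sup>2 * peval q (v l))" if q: "q \<in> polys (2 * t)" for q
    proof -
      have sup: "riesz q z = (\<Sum>\<alpha>\<in>mindices (2 * t). Poly_Mapping.lookup q \<alpha> * z \<alpha>)" for z
        using q by (intro riesz_superset) (auto simp: polys_def)
      show ?thesis
        unfolding peval_eq_riesz sup sum_distrib_left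
        by (subst sum.swap) (simp add: y_expand \<open>s = r\<close> sum_distrib_left mult_ac)
    qed
  qed
qed

section \<open>Atomic decompositions and feasibility\<close>

lemma riesz_eq_atoms_iff:
  fixes y :: "'n::finite mindex \<Rightarrow> real"
  shows "(\<forall>q\<in>polys k. riesz q y = (\<Sum>l\<in>L. lam l * peval q (v l))) \<longleftrightarrow>
   (\<forall>\<alpha>\<in>mindices k. y \<alpha> = (\<Sum>l\<in>L. lam l * mpower (v l) \<alpha>))" (is "?l \<longleftrightarrow> ?r")
proof
  assume l: ?l
  show ?r
  proof
    fix \<alpha> :: "'n mindex" assume "\<alpha> \<in> mindices k"
    with l[rule_format, of "mon \<alpha>"] show "y \<alpha> = (\<Sum>l\<in>L. lam l * mpower (v l) \<alpha>)"
      by (simp add: mon_in_polys)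
  qed
next
  assume r: ?r
  show ?l
  proof
    fix q :: "'n mpoly" assume q: "q \<in> polys k"
    have sup: "riesz q z = (\<Sum>\<alpha>\<in>mindices k. Poly_Mapping.lookup q \<alpha> * z \<alpha>)" for z
      using q by (intro riesz_superset) (auto simp: polys_def)
    show "riesz q y = (\<Sum>l\<in>L. lam l * peval q (v l))"
      unfolding peval_eq_riesz sup sum_distrib_left
      by (subst sum.swap) (simp add: r sum_distrib_left mult_ac)
  qed
qed

lemma peval_square_nonneg: "0 \<le> peval (f * f) x"
  by (simp add: peval_mult)

lemma atomic_decompD:
  assumes "atomic_decomp K t y r v lam"
  shows "q \<in> polys (2 * t) \<Longrightarrow> riesz q y = (\<Sum>l=1..r. lam l * peval q (v l))"
    and "l \<in> {1..r} \<Longrightarrow> v l \<in> K" and "l \<in> {1..r} \<Longrightarrow> 0 < lam l"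
proof -
  have eq: "restrict y (mindices (2 * t)) = (\<lambda>\<alpha>\<in>mindices (2 * t). \<Sum>j=1..r. lam j * mvec (2 * t) (v j) \<alpha>)"
    using assms unfolding atomic_decomp_def by blast
  have "y \<alpha> = (\<Sum>l=1..r. lam l * mpower (v l) \<alpha>)" if "\<alpha> \<in> mindices (2 * t)" for \<alpha>
    using fun_cong[OF eq, of \<alpha>] that by (simp add: mvec_def)
  then have "\<forall>\<alpha>\<in>mindices (2 * t). y \<alpha> = (\<Sum>l=1..r. lam l * mpower (v l) \<alpha>)" by blast
  then show "q \<in> polys (2 * t) \<Longrightarrow> riesz q y = (\<Sum>l=1..r. lam l * peval q (v l))"
    unfolding riesz_eq_atoms_iff[symmetric] by blast
  show "l \<in> {1..r} \<Longrightarrow> v l \<in> K" "l \<in> {1..r} \<Longrightarrow> 0 < lam l"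
    using assms by (auto simp: atomic_decomp_def)
qed

lemma atomic_decompI:
  assumes "\<And>q. q \<in> polys (2 * t) \<Longrightarrow> riesz q y = (\<Sum>l=1..r. lam l * peval q (v l))"
    and "\<And>l. l \<in> {1..r} \<Longrightarrow> v l \<in> K" and "\<And>l. l \<in> {1..r} \<Longrightarrow> 0 < lam l"
    and "inj_on v {1..r}"
  shows "atomic_decomp K t y r v lam"
proof -
  have "\<forall>\<alpha>\<in>mindices (2 * t). y \<alpha> = (\<Sum>l=1..r. lam l * mpower (v l) \<alpha>)"
    unfolding riesz_eq_atoms_iff[symmetric] using assms(1) by blast
  then show ?thesis
    using assms(2-4) by (auto simp: atomic_decomp_def mvec_def restrict_def fun_eq_iff)
qed

lemma moment_cone_atoms:
  assumes "z \<in> moment_cone d K"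
  obtains s :: nat and lam v where "\<And>l. l \<in> {1..s} \<Longrightarrow> 0 \<le> lam l" "\<And>l. l \<in> {1..s} \<Longrightarrow> v l \<in> K"
    "\<And>q. q \<in> polys (2 * d) \<Longrightarrow> riesz q z = (\<Sum>l=1..s. lam l * peval q (v l))"
proof -
  obtain s :: nat and lam v where *: "\<forall>j\<in>{1..s}. lam j \<ge> 0 \<and> v j \<in> K"
    and z: "z = (\<lambda>\<alpha>\<in>mindices (2 * d). \<Sum>j=1..s. lam j * mvec (2 * d) (v j) \<alpha>)"
    using assms by (auto simp: moment_cone_def)
  have "\<forall>\<alpha>\<in>mindices (2 * d). z \<alpha> = (\<Sum>l=1..s. lam l * mpower (v l) \<alpha>)"
    by (simp add: z mvec_def)
  then have "\<forall>q\<in>polys (2 * d). riesz q z = (\<Sum>l=1..s. lam l * peval q (v l))"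
    unfolding riesz_eq_atoms_iff .
  with * that show ?thesis by blast
qed

text \<open>Every conic combination of total mass one of evaluations at feasible points satisfies the
  constraints of the relaxation; this is why the relaxation bounds the moment problem from above.\<close>
lemma relax_feasible_atoms:
  fixes c :: "'j \<Rightarrow> 'n::finite mpoly"
  assumes deg: "\<And>j. j \<in> E \<union> I \<Longrightarrow> half_deg (c j) \<le> k"
    and v: "\<And>l. l \<in> L \<Longrightarrow> v l \<in> feasible_set E I c" and lam: "\<And>l. l \<in> L \<Longrightarrow> 0 \<le> lam l"
    and y: "y \<in> extensional (mindices (2 * k))" "y 0 = 1"
    and at: "\<And>q. q \<in> polys (2 * k) \<Longrightarrow> riesz q y = (\<Sum>l\<in>L. lam l * peval q (v l))"
  shows "y \<in> relax_feasible E I c k"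
proof -
  have deg_prod: "c j * (f * g) \<in> polys (2 * k)"
    if "j \<in> E \<union> I" "f \<in> polys (k - half_deg (c j))" "g \<in> polys (k - half_deg (c j))" for j f g
  proof -
    have "2 * half_deg (c j) + (k - half_deg (c j) + (k - half_deg (c j))) = 2 * k"
      using deg[OF that(1)] by simp
    moreover have "c j * (f * g) \<in> polys (2 * half_deg (c j) + (k - half_deg (c j) + (k - half_deg (c j))))"
      by (intro polys_mult polys_half_deg that)
    ultimately show ?thesis by (simp only:)
  qed
  have "mat_psd (mindices k) (moment_mat y)"
    unfolding moment_eq_localizing psd_localizing_iff
  proof
    fix f :: "'n mpoly" assume "f \<in> polys k"
    then have "1 * (f * f) \<in> polys (2 * k)" using polys_mult[of f k f k] by (simp add: mult_2)
    then show "0 \<le> riesz (1 * (f * f)) y"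
      by (simp only: at mult_1) (intro sum_nonneg mult_nonneg_nonneg lam peval_square_nonneg)
  qed
  moreover have "mat_zero (mindices (k - half_deg (c j))) (localizing_mat (c j) y)" if j: "j \<in> E" for j
    unfolding zero_localizing_iff
  proof (intro ballI)
    fix f g :: "'n mpoly" assume "f \<in> polys (k - half_deg (c j))" "g \<in> polys (k - half_deg (c j))"
    then have "c j * (f * g) \<in> polys (2 * k)" using deg_prod j by blast
    moreover have "peval (c j) (v l) = 0" if "l \<in> L" for l
      using v[OF that] j by (simp add: feasible_set_def)
    ultimately show "riesz (c j * (f * g)) y = 0" by (simp add: at peval_mult)
  qed
  moreover have "mat_psd (mindices (k - half_deg (c j))) (localizing_mat (c j) y)" if j: "j \<in> I" for j
    unfolding psd_localizing_iff
  proof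
    fix f :: "'n mpoly" assume "f \<in> polys (k - half_deg (c j))"
    then have "c j * (f * f) \<in> polys (2 * k)" using deg_prod j by blast
    moreover have "0 \<le> peval (c j) (v l)" if "l \<in> L" for l
      using v[OF that] j by (simp add: feasible_set_def)
    ultimately show "0 \<le> riesz (c j * (f * f)) y"
      by (simp only: at peval_mult[of "c j"])
        (intro sum_nonneg mult_nonneg_nonneg lam peval_square_nonneg)
  qed
  ultimately show ?thesis using y by (simp add: relax_feasible_def)
qed

lemma moment_psd_polys:
  assumes "y \<in> relax_feasible E I c k" "f \<in> polys k"
  shows "0 \<le> riesz (f * f) y"
proof -
  have "mat_psd (mindices k) (localizing_mat 1 y)"
    using assms(1) by (simp add: relax_feasible_def moment_eq_localizing)
  then show ?thesis using assms(2) unfolding psd_localizing_iff by fastforce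
qed

text \<open>The nodes of the quadrature rule lie in the feasible set. The interpolation polynomial \<open>h\<^sub>l\<close>
  has degree at most \<open>t - d\<close>, hence \<open>c\<^sub>j h\<^sub>l\<^sup>2\<close> has degree at most \<open>2 t\<close> and the quadrature rule evaluates
  it to \<open>\<lambda>\<^sub>l c\<^sub>j (v\<^sub>l)\<close>. The same number is a diagonal value of the localizing form of \<open>c\<^sub>j\<close>, so it is
  nonnegative for inequalities and zero for equations.\<close>
lemma flat_truncation_atomic_decomp:
  fixes c :: "'j \<Rightarrow> 'n::finite mpoly"
  assumes y: "y \<in> relax_feasible E I c k"
    and deg: "\<And>j. j \<in> E \<union> I \<Longrightarrow> half_deg (c j) \<le> d" and d: "1 \<le> d" "d \<le> t" "t \<le> k"
    and rk: "mat_rank (mindices t) (moment_mat y) = mat_rank (mindices (t - d)) (moment_mat y)"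
    and r: "r = mat_rank (mindices t) (moment_mat y)"
  shows "\<exists>v lam. atomic_decomp (feasible_set E I c) t y r v lam"
proof -
  have pos: "0 \<le> riesz (f * f) y" if "f \<in> polys t" for f
    using moment_psd_polys[OF y] that polys_subset[OF d(3)] by blast
  obtain v lam and h :: "nat \<Rightarrow> 'n mpoly" where lam: "\<And>l. l \<in> {1..r} \<Longrightarrow> 0 < lam l"
    and h: "\<And>l. l \<in> {1..r} \<Longrightarrow> h l \<in> polys (t - d)"
    and hv: "\<And>l l'. l \<in> {1..r} \<Longrightarrow> l' \<in> {1..r} \<Longrightarrow> peval (h l) (v l') = (if l = l' then 1 else 0)"
    and at: "\<And>q. q \<in> polys (2 * t) \<Longrightarrow> riesz q y = (\<Sum>l=1..r. lam l * peval q (v l))"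
    by (rule flat_truncation_quadrature[OF d(1,2) _ rk r]) (erule pos, rule that)
  have loc: "riesz (c j * (h l * h l)) y = lam l * peval (c j) (v l)" if "j \<in> E \<union> I" "l \<in> {1..r}" for j l
  proof -
    have "c j \<in> polys (2 * d)" 
      using polys_half_deg[of "c j"] polys_subset[of "2 * half_deg (c j)" "2 * d"] deg[OF that(1)] by auto
    then have "c j * (h l * h l) \<in> polys (2 * d + ((t - d) + (t - d)))"
      by (intro polys_mult h that)
    then have "c j * (h l * h l) \<in> polys (2 * t)" using d by (simp add: mult_2)
    then have "riesz (c j * (h l * h l)) y = (\<Sum>l'=1..r. lam l' * peval (c j * (h l * h l)) (v l'))"
      by (rule at)
    also have "\<dots> = (\<Sum>l'=1..r. if l' = l then lam l' * peval (c j) (v l') else 0)"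
      by (rule sum.cong) (use hv[OF that(2)] in \<open>simp_all add: peval_mult\<close>)
    finally show ?thesis using that by simp
  qed
  have hk: "h l \<in> polys (k - half_deg (c j))" if "j \<in> E \<union> I" "l \<in> {1..r}" for j l
  proof -
    have "t - d \<le> k - half_deg (c j)" using deg[OF that(1)] d by simp
    then show ?thesis using h[OF that(2)] polys_subset by blast
  qed
  have "v l \<in> feasible_set E I c" if l: "l \<in> {1..r}" for l
  proof -
    have "peval (c j) (v l) = 0" if j: "j \<in> E" for j
    proof -
      have "riesz (c j * (h l * h l)) y = 0"
        using y j hk[of j l] l by (simp add: relax_feasible_def zero_localizing_iff)
      then show ?thesis using loc[of j l] lam[OF l] j l by simp
    qed
    moreover have "0 \<le> peval (c j) (v l)" if j: "j \<in> I" for j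
    proof -
      have "0 \<le> riesz (c j * (h l * h l)) y"
        using y j hk[of j l] l by (simp add: relax_feasible_def psd_localizing_iff)
      then show ?thesis using loc[of j l] lam[OF l] j l by (simp add: zero_le_mult_iff)
    qed
    ultimately show ?thesis by (simp add: feasible_set_def)
  qed
  moreover have "inj_on v {1..r}"
  proof (rule inj_onI)
    fix l l' assume "l \<in> {1..r}" "l' \<in> {1..r}" "v l = v l'"
    with hv[of l l] hv[of l l'] show "l = l'" by (metis zero_neq_one)
  qed
  ultimately show ?thesis using atomic_decompI[OF at _ lam] by blast
qed

lemma mom_obj_cong: "(\<And>i. i \<in> {1..m} \<Longrightarrow> riesz (p i) y = riesz (p i) z) \<Longrightarrow> mom_obj m a p y = mom_obj m a p z"
  by (simp add: mom_obj_def)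

lemma mom_obj_eq_log_obj:
  "(\<And>i. i \<in> {1..m} \<Longrightarrow> riesz (p i) y = peval (p i) x) \<Longrightarrow> mom_obj m a p y = log_obj m a p x"
  by (simp add: mom_obj_def log_obj_def)

lemma atoms_in_moment_cone:
  fixes z :: "'n::finite mindex \<Rightarrow> real"
  assumes "\<And>l. l \<in> {1..s} \<Longrightarrow> 0 \<le> lam l" "\<And>l. l \<in> {1..s} \<Longrightarrow> v l \<in> K"
    and "\<And>q. q \<in> polys (2 * d) \<Longrightarrow> riesz q z = (\<Sum>l=1..(s::nat). lam l * peval q (v l))"
  shows "restrict z (mindices (2 * d)) \<in> moment_cone d K"
proof -
  have "\<forall>\<alpha>\<in>mindices (2 * d). z \<alpha> = (\<Sum>l=1..s. lam l * mpower (v l) \<alpha>)"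
    unfolding riesz_eq_atoms_iff[symmetric] using assms(3) by blast
  then have "restrict z (mindices (2 * d)) = (\<lambda>\<alpha>\<in>mindices (2 * d). \<Sum>j=1..s. lam j * mvec (2 * d) (v j) \<alpha>)"
    by (auto simp: mvec_def restrict_def)
  then show ?thesis using assms(1,2) unfolding moment_cone_def by blast
qed

section \<open>Comparison of the three optimal values\<close>

lemma log_obj_le_f_mom:
  fixes p :: "nat \<Rightarrow> 'n::finite mpoly"
  assumes p: "\<And>i. i \<in> {1..m} \<Longrightarrow> p i \<in> polys (2 * d)" and x: "x \<in> K"
  shows "log_obj m a p x \<le> f_mom m a p d K"
proof -
  have "mvec (2 * d) x \<in> moment_cone d K"
    unfolding mvec_def
    by (rule atoms_in_moment_cone[where s = 1 and lam = "\<lambda>_. 1" and v = "\<lambda>_. x"])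
      (simp_all add: x peval_eq_riesz)
  moreover have "mvec (2 * d) x 0 = 1" by (simp add: mvec_def)
  moreover have "mom_obj m a p (mvec (2 * d) x) = log_obj m a p x"
  proof (rule mom_obj_eq_log_obj)
    fix i assume "i \<in> {1..m}"
    then show "riesz (p i) (mvec (2 * d) x) = peval (p i) x"
      unfolding peval_eq_riesz by (intro riesz_cong[OF p]) (simp_all add: mvec_def)
  qed
  ultimately show ?thesis unfolding f_mom_def by (intro SUP_upper2) auto
qed

text \<open>An element of the moment cone only has entries up to degree \<open>2 d\<close>; its atoms supply the missing
  entries up to degree \<open>2 k\<close>.\<close>
lemma f_mom_le_f_mom_relax:
  fixes p :: "nat \<Rightarrow> 'n::finite mpoly"
  assumes p: "\<And>i. i \<in> {1..m} \<Longrightarrow> p i \<in> polys (2 * d)" and "d \<le> k"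
    and deg: "\<And>j. j \<in> E \<union> I \<Longrightarrow> half_deg (c j) \<le> d"
  shows "f_mom m a p d (feasible_set E I c) \<le> f_mom_relax m a p E I c k"
  unfolding f_mom_def
proof (rule SUP_least, clarify)
  fix z :: "'n mindex \<Rightarrow> real" assume z: "z \<in> moment_cone d (feasible_set E I c)" "z 0 = 1"
  obtain s :: nat and lam v where lam: "\<And>l. l \<in> {1..s} \<Longrightarrow> 0 \<le> lam l"
    and v: "\<And>l. l \<in> {1..s} \<Longrightarrow> v l \<in> feasible_set E I c"
    and at: "\<And>q. q \<in> polys (2 * d) \<Longrightarrow> riesz q z = (\<Sum>l=1..s. lam l * peval q (v l))"
    by (rule moment_cone_atoms[OF z(1)]) (rule that)
  define y where "y = (\<lambda>\<alpha>\<in>mindices (2 * k). \<Sum>l=1..s. lam l * mpower (v l) \<alpha>)"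
  have "\<forall>\<alpha>\<in>mindices (2 * k). y \<alpha> = (\<Sum>l=1..s. lam l * mpower (v l) \<alpha>)" by (simp add: y_def)
  then have aty: "riesz q y = (\<Sum>l=1..s. lam l * peval q (v l))" if "q \<in> polys (2 * k)" for q
    using that unfolding riesz_eq_atoms_iff[symmetric] by blast
  have yz: "riesz q y = riesz q z" if "q \<in> polys (2 * d)" for q
  proof -
    have "q \<in> polys (2 * k)" using that \<open>d \<le> k\<close> polys_subset[of "2 * d" "2 * k"] by auto
    then show ?thesis using at[OF that] aty by simp
  qed
  have "y 0 = 1" using yz[of "mon 0"] z(2) by (simp add: mon_in_polys)
  have "y \<in> relax_feasible E I c k"
  proof (rule relax_feasible_atoms[OF _ v lam _ \<open>y 0 = 1\<close> aty])
    show "half_deg (c j) \<le> k" if "j \<in> E \<union> I" for j using deg[OF that] \<open>d \<le> k\<close> by simp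
    show "y \<in> extensional (mindices (2 * k))" by (simp add: y_def)
  qed
  moreover have "mom_obj m a p z = mom_obj m a p y"
    by (rule mom_obj_cong) (simp add: yz p)
  ultimately show "mom_obj m a p z \<le> f_mom_relax m a p E I c k"
    unfolding f_mom_relax_def by (intro SUP_upper2) auto
qed

lemma mom_obj_le_f_mom:
  fixes p :: "nat \<Rightarrow> 'n::finite mpoly"
  assumes p: "\<And>i. i \<in> {1..m} \<Longrightarrow> p i \<in> polys (2 * d)" and "d \<le> t" and "y 0 = 1"
    and dec: "atomic_decomp K t y r v lam"
  shows "mom_obj m a p y \<le> f_mom m a p d K"
proof -
  define z where "z = restrict y (mindices (2 * d))"
  have "z \<in> moment_cone d K"
    unfolding z_def
  proof (rule atoms_in_moment_cone)
    show "riesz q y = (\<Sum>l=1..r. lam l * peval q (v l))" if "q \<in> polys (2 * d)" for q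
      using that \<open>d \<le> t\<close> polys_subset[of "2 * d" "2 * t"] by (intro atomic_decompD(1)[OF dec]) auto
  qed (use atomic_decompD[OF dec] in \<open>auto intro: less_imp_le\<close>)
  moreover have "z 0 = 1" using \<open>y 0 = 1\<close> by (simp add: z_def)
  moreover have "mom_obj m a p y = mom_obj m a p z"
    by (rule mom_obj_cong, rule riesz_cong[OF p]) (simp_all add: z_def)
  ultimately show ?thesis unfolding f_mom_def by (intro SUP_upper2) auto
qed

text \<open>The weights sum to \<open>y 0 = 1\<close>, so the functional averages each \<open>p i\<close> over the atoms; if \<open>p i\<close> takes
  one and the same value at all atoms, the average is that value.\<close>
lemma log_obj_atom_eq_mom_obj:
  fixes p :: "nat \<Rightarrow> 'n::finite mpoly"
  assumes p: "\<And>i. i \<in> {1..m} \<Longrightarrow> p i \<in> polys (2 * t)" and "y 0 = 1"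
    and dec: "atomic_decomp K t y r v lam"
    and const: "\<And>i l. i \<in> {1..m} \<Longrightarrow> l \<in> {1..r} \<Longrightarrow> peval (p i) (v l) = peval (p i) x"
  shows "mom_obj m a p y = log_obj m a p x"
proof (rule mom_obj_eq_log_obj)
  fix i assume i: "i \<in> {1..m}"
  have "(\<Sum>l=1..r. lam l) = 1"
    using atomic_decompD(1)[OF dec, of "mon 0"] \<open>y 0 = 1\<close> by (simp add: mon_in_polys)
  moreover have "riesz (p i) y = (\<Sum>l=1..r. lam l * peval (p i) x)"
    using atomic_decompD(1)[OF dec p[OF i]] const[OF i] by simp
  ultimately show "riesz (p i) y = peval (p i) x" by (simp add: sum_distrib_right[symmetric])
qed

section \<open>Exactness of the moment relaxation under flat truncation\<close>

text \<open>The optimal value of the relaxation is attained at \<open>y\<close>. Truncated to degree \<open>2 d\<close>, the flat \<open>y\<close>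
  becomes a feasible point of the moment problem with the same objective value, and the opposite
  inequality between the two problems always holds. If \<open>p\<close> is constant on the atoms, each atom has
  the objective value of \<open>y\<close>, which bounds the objective on the feasible set from above.\<close>
theorem theorem4p1:
  fixes m :: nat and a :: "nat \<Rightarrow> real" and p :: "nat \<Rightarrow> 'n::finite mpoly"
    and E I :: "'j set" and c :: "'j \<Rightarrow> 'n mpoly"
    and K :: "(real ^ 'n) set"
    and d k t r :: nat and y :: "'n mindex \<Rightarrow> real"
  assumes "m \<ge> 1"
    and "\<And>i. i \<in> {1..m} \<Longrightarrow> a i > 0"
    and "finite E" and "finite I" and "E \<inter> I = {}"
    and "K = feasible_set E I c"
    and "\<And>i x. i \<in> {1..m} \<Longrightarrow> x \<in> K \<Longrightarrow> peval (p i) x \<ge> 0"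
    and "\<exists>xh\<in>K. \<forall>i\<in>{1..m}. peval (p i) xh > 0"
    and "d = Max (half_deg ` (p ` {1..m} \<union> c ` (E \<union> I)))"
    and "d \<ge> 1"
    and "k \<ge> d"
    and "is_arg_max (mom_obj m a p) (\<lambda>y. y \<in> relax_feasible E I c k) y"
    and "t \<in> {d..k}"
    and "mat_rank (mindices t) (moment_mat y) = mat_rank (mindices (t - d)) (moment_mat y)"
    and "r = mat_rank (mindices t) (moment_mat y)"
  shows "f_mom_relax m a p E I c k = f_mom m a p d K \<and>
    (\<exists>v lam. atomic_decomp K t y r v lam) \<and>
    (\<forall>v lam. atomic_decomp K t y r v lam \<and>
        (\<forall>j\<in>{1..r}. \<forall>j'\<in>{1..r}. \<forall>i\<in>{1..m}. peval (p i) (v j) = peval (p i) (v j')) \<longrightarrow>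
      f_max m a p K = f_mom m a p d K \<and> f_mom m a p d K = f_mom_relax m a p E I c k \<and>
      (\<forall>j\<in>{1..r}. is_arg_max (log_obj m a p) (\<lambda>x. x \<in> K) (v j)))"
proof -
  note K = assms(6)
  have fin: "finite (half_deg ` (p ` {1..m} \<union> c ` (E \<union> I)))" using assms(3,4) by simp
  have deg_c: "half_deg (c j) \<le> d" if "j \<in> E \<union> I" for j
    unfolding assms(9) by (rule Max_ge[OF fin]) (use that in auto)
  have deg_p: "half_deg (p i) \<le> d" if "i \<in> {1..m}" for i
    unfolding assms(9) by (rule Max_ge[OF fin]) (use that in auto)
  have p: "p i \<in> polys (2 * d)" if "i \<in> {1..m}" for i
    using polys_half_deg[of "p i"] polys_subset[of "2 * half_deg (p i)" "2 * d"] deg_p[OF that] by auto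
  have t: "d \<le> t" "t \<le> k" using assms(13) by auto
  have pt: "p i \<in> polys (2 * t)" if "i \<in> {1..m}" for i
    using p[OF that] polys_subset[of "2 * d" "2 * t"] t by auto
  have y: "y \<in> relax_feasible E I c k" and opt: "\<And>z. z \<in> relax_feasible E I c k \<Longrightarrow> mom_obj m a p z \<le> mom_obj m a p y"
    using assms(12) by (auto simp: is_arg_max_def not_less)
  have y0: "y 0 = 1" using y by (simp add: relax_feasible_def)
  have relax: "f_mom_relax m a p E I c k = mom_obj m a p y"
    unfolding f_mom_relax_def using y opt by (intro antisym SUP_least SUP_upper)
  obtain v0 lam0 where dec0: "atomic_decomp K t y r v0 lam0"
    using flat_truncation_atomic_decomp[OF y deg_c assms(10) t assms(14,15)] K by blast
  have mom: "f_mom m a p d K = mom_obj m a p y"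
  proof (rule antisym)
    have "f_mom m a p d (feasible_set E I c) \<le> f_mom_relax m a p E I c k"
      by (rule f_mom_le_f_mom_relax[OF p assms(11) deg_c])
    then show "f_mom m a p d K \<le> mom_obj m a p y" by (simp only: K relax)
    show "mom_obj m a p y \<le> f_mom m a p d K" by (rule mom_obj_le_f_mom[OF p t(1) y0 dec0])
  qed
  have "f_max m a p K = mom_obj m a p y \<and> (\<forall>j\<in>{1..r}. is_arg_max (log_obj m a p) (\<lambda>x. x \<in> K) (v j))"
    if dec: "atomic_decomp K t y r v lam"
      and const: "\<forall>j\<in>{1..r}. \<forall>j'\<in>{1..r}. \<forall>i\<in>{1..m}. peval (p i) (v j) = peval (p i) (v j')" for v lam
  proof -
    have at: "log_obj m a p (v j) = mom_obj m a p y" if "j \<in> {1..r}" for j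
      using const that by (intro log_obj_atom_eq_mom_obj[OF pt y0 dec, symmetric]) blast+
    have le: "log_obj m a p x \<le> mom_obj m a p y" if "x \<in> K" for x
      unfolding mom[symmetric] by (rule log_obj_le_f_mom[OF p that])
    have "r \<noteq> 0"
    proof
      assume "r = 0"
      then show False using atomic_decompD(1)[OF dec, of "mon 0"] y0 by (simp add: mon_in_polys)
    qed
    then have one: "1 \<in> {1..r}" by simp
    have "f_max m a p K = mom_obj m a p y"
      unfolding f_max_def
      using at[OF one] atomic_decompD(2)[OF dec one] le by (intro antisym SUP_least SUP_upper2[of "v 1"]) auto
    moreover have "is_arg_max (log_obj m a p) (\<lambda>x. x \<in> K) (v j)" if "j \<in> {1..r}" for j
      using at[OF that] atomic_decompD(2)[OF dec that] le by (auto simp: is_arg_max_def not_less)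
    ultimately show ?thesis by blast
  qed
  then show ?thesis unfolding relax mom using dec0 by blast
qed

end
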